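(* Let $(\mathfrak{g},\langle\cdot,\cdot\rangle)$ be a non-commutative flat Lie algebra, let $r\in\wedge^2\mathfrak{g}$ be a bivector, and let $\xi:\mathfrak{g}\to\wedge^2\mathfrak{g}$, $\xi(x)=\mathrm{ad}_x r$, be the associated $1$-coboundary. If $(\mathfrak{g},\langle\cdot,\cdot\rangle,\xi)$ is metaflat, then $r$ is a solution of the classical Yang-Baxter equation $[r,r]=0$. Moreover, the dual Lie bialgebra $(\mathfrak{g}^*,[\cdot,\cdot]_*,\xi^* )$ is flat and metaflat for the dual positive-definite scalar product $\langle\cdot,\cdot\rangle^*$ on $\mathfrak{g}^*$.
   Context: All Lie algebras are real and finite-dimensional. Flat Lie algebra: a Lie algebra $\mathfrak{g}$ with a positive definite scalar product $\langle\cdot,\cdot\rangle$ such that the infinitesimal Levi-Civita connection defined by $2\langle\nabla_xy,z\rangle=\langle[x,y],z\rangle+\langle[z,x],y\rangle+\langle[z,y],x\rangle$ has zero curvature: $\nabla_{[x,y]}z-(\nabla_x\nabla_yz-\nabla_y\nabla_xz)=0$ for all $x,y,z\in\mathfrak{g}$. Known structure: a flat Lie algebra decomposes orthogonally as $\mathfrak{g}=\mathfrak{s}\oplus\mathfrak{z}\oplus\mathfrak{d}$, where $\mathfrak{z}$ is the center, $\mathfrak{d}=[\mathfrak{g},\mathfrak{g}]$ is the commutator ideal (abelian and even-dimensional), and $\mathfrak{s}$, the orthogonal complement of $\mathfrak{z}\oplus\mathfrak{d}$, is an abelian subalgebra; moreover $\mathrm{ad}_x=\nabla_x$ for $x\in\mathfrak{s}\oplus\mathfrak{z}$.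 The adjoint action on bivectors is $\mathrm{ad}_x(y\wedge z)=[x,y]\wedge z+y\wedge[x,z]$. A $1$-cocycle is a linear map $\xi:\mathfrak{g}\to\wedge^2\mathfrak{g}$ with $\xi([x,y])=\mathrm{ad}_x\xi(y)-\mathrm{ad}_y\xi(x)$ for all $x,y$; every map $x\mapsto\mathrm{ad}_xr$ is a $1$-cocycle, called the $1$-coboundary associated to $r$. Metaflat: a flat Lie algebra $(\mathfrak{g},\langle\cdot,\cdot\rangle)$ with a $1$-cocycle $\xi$ is metaflat if $\mathrm{ad}_x\mathrm{ad}_y\xi(z)=0$ for all $x,y,z\in\mathfrak{s}$, where $\mathfrak{s}$ is the summand in the decomposition above. For $\mathfrak{g}^*$ the same definition is applied to the Lie algebra $(\mathfrak{g}^*,[\cdot,\cdot]_* )$ with scalar product $\langle\cdot,\cdot\rangle^*$ and $1$-cocycle $\xi^*$. A commutative Lie algebra is flat and metaflat. Bracket of bivectors: $[\cdot,\cdot]:\wedge^2\mathfrak{g}\times\wedge^2\mathfrak{g}\to\wedge^3\mathfrak{g}$ is the (Schouten-Nijenhuis) $\mathbb{R}$-bilinear bracket determined by $[X_1\wedge X_2,Y_1\wedge Y_2]=[X_1,Y_1]\wedge X_2\wedge Y_2-[X_1,Y_2]\wedge X_2\wedge Y_1-[X_2,Y_1]\wedge X_1\wedge Y_2+[X_2,Y_2]\wedge X_1\wedge Y_1$. Dual Lie bialgebra: $[\cdot,\cdot]_*=\xi^t:\wedge^2\mathfrak{g}^*\to\mathfrak{g}^*$ is the transpose, $\langle[\alpha,\beta]_*,x\rangle=\langle\alpha\wedge\beta,\xi(x)\rangle$,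 which has to be a Lie bracket on $\mathfrak{g}^*$ for $(\mathfrak{g},\xi)$ to be a Lie bialgebra; the dual $1$-cocycle $\xi^*:\mathfrak{g}^*\to\wedge^2\mathfrak{g}^*$ is $\xi^*(\alpha)(x\wedge y)=\alpha([x,y])$. Here $\langle\alpha\wedge\beta,x\wedge y\rangle=\alpha(x)\beta(y)-\alpha(y)\beta(x)$. Dual scalar product: with $\sharp:\mathfrak{g}\to\mathfrak{g}^*$, $\sharp(x)(y)=\langle x,y\rangle$, one sets $\langle\sharp(x),\sharp(y)\rangle^*=\langle x,y\rangle$. *)

theory Defs
  imports "HOL-Analysis.Analysis"
begin

section \<open>Bivectors and trivectors\<close>

text \<open>
  For a finite-dimensional space \<open>V\<close> the dual \<open>V*\<close> is the type of bounded linear functionals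
  on \<open>V\<close>. The exterior powers of \<open>V\<close> are realised inside the multilinear forms on \<open>V*\<close>, with the
  normalisation in which \<open>x \<and> y\<close> is the form \<open>(\<alpha>, \<beta>) \<mapsto> \<alpha>(x) \<beta>(y) - \<alpha>(y) \<beta>(x)\<close>
  (lemma \<open>wedge_apply\<close>) and \<open>x \<and> y \<and> z\<close> is the \<open>3 \<times> 3\<close> determinant (lemma \<open>wedge3_apply\<close>).
\<close>

type_synonym 'v dual = "'v \<Rightarrow>\<^sub>L real"
type_synonym 'v bivector = "'v dual \<Rightarrow>\<^sub>L 'v dual \<Rightarrow>\<^sub>L real"
type_synonym 'v trivector = "'v dual \<Rightarrow>\<^sub>L 'v dual \<Rightarrow>\<^sub>L 'v dual \<Rightarrow>\<^sub>L real"

definition evaluation :: "'v::real_normed_vector \<Rightarrow> 'v dual dual" where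
  "evaluation x = Blinfun (\<lambda>\<alpha>. blinfun_apply \<alpha> x)"

definition tensor :: "'v::real_normed_vector \<Rightarrow> 'w::real_normed_vector \<Rightarrow> 'v dual \<Rightarrow>\<^sub>L 'w" where
  "tensor x w = Blinfun (\<lambda>\<alpha>. blinfun_apply \<alpha> x *\<^sub>R w)"

definition wedge :: "'v::real_normed_vector \<Rightarrow> 'v \<Rightarrow> 'v bivector" where
  "wedge x y = tensor x (evaluation y) - tensor y (evaluation x)"

definition wedge3 :: "'v::real_normed_vector \<Rightarrow> 'v \<Rightarrow> 'v \<Rightarrow> 'v trivector" where
  "wedge3 x y z = tensor x (wedge y z) + tensor y (wedge z x) + tensor z (wedge x y)"

definition bivectors :: "'v::real_normed_vector bivector set" where
  "bivectors = span {wedge x y | x y. True}"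

text \<open>
  The linear map on \<open>\<and>\<^sup>2V\<close> induced by an alternating bilinear map \<open>h\<close>, that is, the one with
  \<open>x \<and> y \<mapsto> h x y\<close>. It exists by lemma \<open>wedge_lift_exists\<close>; its values on
  \<open>bivectors\<close> are determined by \<open>h\<close> (lemma \<open>linear_eq_on_bivectors\<close>), and only these values are ever used.
\<close>

definition wedge_lift ::
  "('v::real_normed_vector \<Rightarrow> 'v \<Rightarrow> 'w::real_vector) \<Rightarrow> 'v bivector \<Rightarrow> 'w" where
  "wedge_lift h = (SOME L. linear L \<and> (\<forall>x y. L (wedge x y) = h x y))"

text \<open>The pairing of \<open>\<and>\<^sup>2V*\<close> with \<open>\<and>\<^sup>2V\<close>, see lemma \<open>bivector_pairing_wedge\<close>.\<close>

definition bivector_pairing :: "'v::real_normed_vector dual bivector \<Rightarrow> 'v bivector \<Rightarrow> real" where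
  "bivector_pairing \<phi> \<omega> =
     wedge_lift (\<lambda>(\<alpha>::'v dual) (\<beta>::'v dual). wedge_lift (\<lambda>x y. \<alpha> x * \<beta> y - \<alpha> y * \<beta> x) \<omega>) \<phi>"


section \<open>Lie algebras and Lie bialgebras\<close>

definition lie_algebra :: "('v::real_vector \<Rightarrow> 'v \<Rightarrow> 'v) \<Rightarrow> bool" where
  "lie_algebra br \<longleftrightarrow>
     (\<exists>B. finite B \<and> span B = (UNIV :: 'v set)) \<and>
     bilinear br \<and>
     (\<forall>x. br x x = 0) \<and>
     (\<forall>x y z. br x (br y z) + br y (br z x) + br z (br x y) = 0)"

definition commutative_bracket :: "('v::real_vector \<Rightarrow> 'v \<Rightarrow> 'v) \<Rightarrow> bool" where
  "commutative_bracket br \<longleftrightarrow> (\<forall>x y. br x y = 0)"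

definition lie_center :: "('v::real_vector \<Rightarrow> 'v \<Rightarrow> 'v) \<Rightarrow> 'v set" where
  "lie_center br = {x. \<forall>y. br x y = 0}"

definition commutator_ideal :: "('v::real_vector \<Rightarrow> 'v \<Rightarrow> 'v) \<Rightarrow> 'v set" where
  "commutator_ideal br = span {br x y | x y. True}"

definition ad_bivector ::
  "('v::real_normed_vector \<Rightarrow> 'v \<Rightarrow> 'v) \<Rightarrow> 'v \<Rightarrow> 'v bivector \<Rightarrow> 'v bivector" where
  "ad_bivector br x = wedge_lift (\<lambda>y z. wedge (br x y) z + wedge y (br x z))"

definition schouten ::
  "('v::real_normed_vector \<Rightarrow> 'v \<Rightarrow> 'v) \<Rightarrow> 'v bivector \<Rightarrow> 'v bivector \<Rightarrow> 'v trivector" where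
  "schouten br r s =
     wedge_lift (\<lambda>X1 X2. wedge_lift (\<lambda>Y1 Y2.
        wedge3 (br X1 Y1) X2 Y2 - wedge3 (br X1 Y2) X2 Y1
      - wedge3 (br X2 Y1) X1 Y2 + wedge3 (br X2 Y2) X1 Y1) s) r"

definition one_cocycle ::
  "('v::real_normed_vector \<Rightarrow> 'v \<Rightarrow> 'v) \<Rightarrow> ('v \<Rightarrow> 'v bivector) \<Rightarrow> bool" where
  "one_cocycle br \<xi> \<longleftrightarrow>
     linear \<xi> \<and> (\<forall>x. \<xi> x \<in> bivectors) \<and>
     (\<forall>x y. \<xi> (br x y) = ad_bivector br x (\<xi> y) - ad_bivector br y (\<xi> x))"

definition coboundary ::
  "('v::real_normed_vector \<Rightarrow> 'v \<Rightarrow> 'v) \<Rightarrow> 'v bivector \<Rightarrow> 'v \<Rightarrow> 'v bivector" where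
  "coboundary br r x = ad_bivector br x r"

text \<open>The bracket \<open>[\<alpha>, \<beta>]\<^sub>*\<close> on the dual space, i.e. the transpose of \<open>\<xi>\<close>.\<close>

definition dual_bracket ::
  "('v::real_normed_vector \<Rightarrow> 'v bivector) \<Rightarrow> 'v dual \<Rightarrow> 'v dual \<Rightarrow> 'v dual" where
  "dual_bracket \<xi> \<alpha> \<beta> = Blinfun (\<lambda>x. bivector_pairing (wedge \<alpha> \<beta>) (\<xi> x))"

definition dual_cocycle ::
  "('v::real_normed_vector \<Rightarrow> 'v \<Rightarrow> 'v) \<Rightarrow> 'v dual \<Rightarrow> 'v dual bivector" where
  "dual_cocycle br \<alpha> =
     (THE \<phi>. \<phi> \<in> bivectors \<and> (\<forall>x y. bivector_pairing \<phi> (wedge x y) = \<alpha> (br x y)))"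

definition lie_bialgebra ::
  "('v::real_normed_vector \<Rightarrow> 'v \<Rightarrow> 'v) \<Rightarrow> ('v \<Rightarrow> 'v bivector) \<Rightarrow> bool" where
  "lie_bialgebra br \<xi> \<longleftrightarrow>
     lie_algebra br \<and> one_cocycle br \<xi> \<and> lie_algebra (dual_bracket \<xi>)"


section \<open>Flat and metaflat Lie algebras\<close>

definition scalar_product :: "('v::real_vector \<Rightarrow> 'v \<Rightarrow> real) \<Rightarrow> bool" where
  "scalar_product ip \<longleftrightarrow>
     bilinear ip \<and> (\<forall>x y. ip x y = ip y x) \<and> (\<forall>x. x \<noteq> 0 \<longrightarrow> ip x x > 0)"

definition levi_civita ::
  "('v::real_vector \<Rightarrow> 'v \<Rightarrow> 'v) \<Rightarrow> ('v \<Rightarrow> 'v \<Rightarrow> real) \<Rightarrow> 'v \<Rightarrow> 'v \<Rightarrow> 'v" where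
  "levi_civita br ip x y =
     (THE v. \<forall>z. 2 * ip v z = ip (br x y) z + ip (br z x) y + ip (br z y) x)"

definition flat_lie_algebra ::
  "('v::real_vector \<Rightarrow> 'v \<Rightarrow> 'v) \<Rightarrow> ('v \<Rightarrow> 'v \<Rightarrow> real) \<Rightarrow> bool" where
  "flat_lie_algebra br ip \<longleftrightarrow>
     lie_algebra br \<and> scalar_product ip \<and>
     (let D = levi_civita br ip in
       \<forall>x y z. D (br x y) z - (D x (D y z) - D y (D x z)) = 0)"

text \<open>The summand \<open>\<s>\<close> of a flat Lie algebra.\<close>

definition flat_complement ::
  "('v::real_vector \<Rightarrow> 'v \<Rightarrow> 'v) \<Rightarrow> ('v \<Rightarrow> 'v \<Rightarrow> real) \<Rightarrow> 'v set" where
  "flat_complement br ip =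
     {x. \<forall>c \<in> lie_center br. \<forall>d \<in> commutator_ideal br. ip x (c + d) = 0}"

definition metaflat ::
  "('v::real_normed_vector \<Rightarrow> 'v \<Rightarrow> 'v) \<Rightarrow> ('v \<Rightarrow> 'v \<Rightarrow> real) \<Rightarrow> ('v \<Rightarrow> 'v bivector) \<Rightarrow> bool" where
  "metaflat br ip \<xi> \<longleftrightarrow>
     flat_lie_algebra br ip \<and> one_cocycle br \<xi> \<and>
     (\<forall>x \<in> flat_complement br ip. \<forall>y \<in> flat_complement br ip. \<forall>z \<in> flat_complement br ip.
        ad_bivector br x (ad_bivector br y (\<xi> z)) = 0)"

text \<open>
  The isomorphism \<open>\<sharp>\<close> onto the dual, \<open>\<sharp>(x)(y) = \<langle>x, y\<rangle>\<close>, is \<open>blinfun_inner_right\<close>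
  (bijective by lemma \<open>bij_blinfun_inner_right\<close>).
\<close>

definition dual_inner :: "'v::euclidean_space dual \<Rightarrow> 'v dual \<Rightarrow> real" where
  "dual_inner \<alpha> \<beta> = inv blinfun_inner_right \<alpha> \<bullet> inv blinfun_inner_right \<beta>"


section \<open>Existence and uniqueness facts behind the definitions\<close>

lemma evaluation_apply [simp]: "evaluation x \<alpha> = \<alpha> x"
  unfolding evaluation_def
  by (simp add: bounded_linear_Blinfun_apply blinfun.bounded_linear_left)

lemma tensor_apply [simp]: "tensor x w \<alpha> = \<alpha> x *\<^sub>R w"
proof -
  have "bounded_linear (\<lambda>\<alpha>. blinfun_apply \<alpha> x *\<^sub>R w)"
    by (rule bounded_linear_scaleR_const[OF blinfun.bounded_linear_left])
  then show ?thesis unfolding tensor_def by (simp add: bounded_linear_Blinfun_apply)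
qed

lemma wedge_apply: "wedge x y \<alpha> \<beta> = \<alpha> x * \<beta> y - \<alpha> y * \<beta> x"
  unfolding wedge_def by (simp add: blinfun.diff_left blinfun.scaleR_left)

lemma wedge3_apply:
  "wedge3 x y z \<alpha> \<beta> \<gamma> =
     \<alpha> x * (\<beta> y * \<gamma> z - \<beta> z * \<gamma> y) - \<alpha> y * (\<beta> x * \<gamma> z - \<beta> z * \<gamma> x)
   + \<alpha> z * (\<beta> x * \<gamma> y - \<beta> y * \<gamma> x)"
  unfolding wedge3_def
  by (simp add: blinfun.add_left blinfun.scaleR_left wedge_apply algebra_simps)

lemma bivector_eqI:
  fixes \<omega> \<omega>' :: "'v::real_normed_vector bivector"
  assumes "\<And>\<alpha> \<beta>. \<omega> \<alpha> \<beta> = \<omega>' \<alpha> \<beta>"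
  shows "\<omega> = \<omega>'"
  using assms by (intro blinfun_eqI) simp

lemma trivector_eqI:
  fixes \<omega> \<omega>' :: "'v::real_normed_vector trivector"
  assumes "\<And>\<alpha> \<beta> \<gamma>. \<omega> \<alpha> \<beta> \<gamma> = \<omega>' \<alpha> \<beta> \<gamma>"
  shows "\<omega> = \<omega>'"
  using assms by (intro blinfun_eqI) simp

lemma wedge_in_bivectors: "wedge x y \<in> bivectors"
  unfolding bivectors_def by (rule span_base) blast

lemma bilinear_wedge: "bilinear wedge"
  unfolding bilinear_def
  by (auto intro!: linearI bivector_eqI
      simp: wedge_apply blinfun.add_left blinfun.scaleR_left blinfun.add_right
        blinfun.scaleR_right algebra_simps)

lemma wedge_self: "wedge x x = 0"
  by (rule bivector_eqI) (simp add: wedge_apply)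

definition alternating_bilinear :: "('v::real_vector \<Rightarrow> 'v \<Rightarrow> 'w::real_vector) \<Rightarrow> bool" where
  "alternating_bilinear h \<longleftrightarrow> bilinear h \<and> (\<forall>x. h x x = 0)"

text \<open>A finite basis together with its (bounded) dual basis.\<close>

definition dual_bases ::
  "'i set \<Rightarrow> ('i \<Rightarrow> 'v::real_normed_vector) \<Rightarrow> ('i \<Rightarrow> 'v dual) \<Rightarrow> bool" where
  "dual_bases I b c \<longleftrightarrow> finite I \<and> (\<forall>x. x = (\<Sum>i\<in>I. c i x *\<^sub>R b i))"

lemma dual_bases_euclidean: "dual_bases Basis (\<lambda>i. i) (blinfun_inner_right :: 'v::euclidean_space \<Rightarrow> _)"
  unfolding dual_bases_def by (simp add: inner_commute euclidean_representation)

lemma dual_bases_dual: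
  fixes b :: "'i \<Rightarrow> 'v::real_normed_vector"
  assumes "dual_bases I b c"
  shows "dual_bases I c (\<lambda>i. evaluation (b i))"
  unfolding dual_bases_def
proof (intro conjI allI)
  show "finite I" using assms by (simp add: dual_bases_def)
  fix \<alpha> :: "'v dual"
  show "\<alpha> = (\<Sum>i\<in>I. evaluation (b i) \<alpha> *\<^sub>R c i)"
  proof (rule blinfun_eqI)
    fix x
    have "\<alpha> x = \<alpha> (\<Sum>i\<in>I. c i x *\<^sub>R b i)"
      using assms by (simp add: dual_bases_def)
    also have "\<dots> = (\<Sum>i\<in>I. evaluation (b i) \<alpha> *\<^sub>R c i) x"
      by (simp add: blinfun.sum_right blinfun.scaleR_right blinfun.sum_left
          blinfun.scaleR_left mult.commute)
    finally show "\<alpha> x = (\<Sum>i\<in>I. evaluation (b i) \<alpha> *\<^sub>R c i) x" .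
  qed
qed

lemma alternating_swap:
  assumes "alternating_bilinear h"
  shows "h y x = - h x y"
proof -
  have b: "bilinear h" and a: "\<And>x. h x x = 0"
    using assms by (auto simp: alternating_bilinear_def)
  have "h (x + y) (x + y) = h x x + h x y + (h y x + h y y)"
    by (simp add: bilinear_ladd[OF b] bilinear_radd[OF b])
  then show ?thesis by (simp add: a eq_neg_iff_add_eq_0 add.commute)
qed

lemma bilinear_expand:
  fixes b :: "'i \<Rightarrow> 'v::real_normed_vector" and h :: "'v \<Rightarrow> 'v \<Rightarrow> 'w::real_vector"
  assumes "dual_bases I b c" "bilinear h"
  shows "h x y = (\<Sum>i\<in>I. \<Sum>j\<in>I. (c i x * c j y) *\<^sub>R h (b i) (b j))"
proof -
  have f: "finite I" and e: "\<And>x. x = (\<Sum>i\<in>I. c i x *\<^sub>R b i)"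
    using assms(1) by (auto simp: dual_bases_def)
  have l: "linear (\<lambda>x. h x y)" and r: "\<And>x. linear (h x)" for y
    using assms(2) by (auto simp: bilinear_def)
  have "h x y = h (\<Sum>i\<in>I. c i x *\<^sub>R b i) (\<Sum>j\<in>I. c j y *\<^sub>R b j)"
    using e by metis
  also have "\<dots> = (\<Sum>i\<in>I. c i x *\<^sub>R h (b i) (\<Sum>j\<in>I. c j y *\<^sub>R b j))"
    by (simp add: linear_sum[OF l] linear_cmul[OF l])
  also have "\<dots> = (\<Sum>i\<in>I. \<Sum>j\<in>I. (c i x * c j y) *\<^sub>R h (b i) (b j))"
    by (simp add: linear_sum[OF r] linear_cmul[OF r] scaleR_sum_right)
  finally show ?thesis .
qed

lemma wedge_lift_exists:
  fixes b :: "'i \<Rightarrow> 'v::real_normed_vector" and h :: "'v \<Rightarrow> 'v \<Rightarrow> 'w::real_vector"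
  assumes D: "dual_bases I b c" and h: "alternating_bilinear h"
  shows "\<exists>L. linear L \<and> (\<forall>x y. L (wedge x y) = h x y)"
proof (intro exI conjI allI)
  define L where "L = (\<lambda>\<omega> :: 'v bivector. (1/2) *\<^sub>R (\<Sum>i\<in>I. \<Sum>j\<in>I. \<omega> (c i) (c j) *\<^sub>R h (b i) (b j)))"
  have b: "bilinear h" using h by (simp add: alternating_bilinear_def)
  show "linear L"
    unfolding L_def
    by (rule linearI)
       (simp_all add: blinfun.add_left blinfun.scaleR_left scaleR_add_left
          sum.distrib scaleR_add_right scaleR_sum_right mult.commute mult.left_commute)
  fix x y
  have "L (wedge x y) = (1/2) *\<^sub>R (h x y - h y x)"
    unfolding L_def bilinear_expand[OF D b, of x y] bilinear_expand[OF D b, of y x]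
    by (simp add: wedge_apply scaleR_diff_left sum_subtractf mult.commute)
  also have "\<dots> = h x y"
    by (simp add: alternating_swap[OF h, of y x] flip: scaleR_2)
  finally show "L (wedge x y) = h x y" .
qed

lemma
  fixes b :: "'i \<Rightarrow> 'v::real_normed_vector" and h :: "'v \<Rightarrow> 'v \<Rightarrow> 'w::real_vector"
  assumes "dual_bases I b c" "alternating_bilinear h"
  shows linear_wedge_lift: "linear (wedge_lift h)"
    and wedge_lift_wedge: "wedge_lift h (wedge x y) = h x y"
  using someI_ex[OF wedge_lift_exists[OF assms]] unfolding wedge_lift_def by auto

lemma linear_eq_on_bivectors:
  assumes "linear L" "linear L'" "\<And>x y. L (wedge x y) = L' (wedge x y)" "\<omega> \<in> bivectors"
  shows "L \<omega> = L' \<omega>"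
  by (rule linear_eq_on[OF assms(1,2), where B = "{wedge x y | x y. True}"])
     (use assms in \<open>auto simp: bivectors_def\<close>)

lemma alternating_ad:
  assumes "bilinear br"
  shows "alternating_bilinear (\<lambda>y z. wedge (br x y) z + wedge y (br x z))"
  unfolding alternating_bilinear_def bilinear_def
  by (auto intro!: linearI bivector_eqI
      simp: wedge_apply bilinear_radd[OF assms] bilinear_rmul[OF assms] blinfun.add_left
        blinfun.scaleR_left blinfun.add_right blinfun.scaleR_right algebra_simps)

lemma ad_bivector_wedge:
  fixes b :: "'i \<Rightarrow> 'v::real_normed_vector"
    and br :: "'v \<Rightarrow> 'v \<Rightarrow> 'v"
  assumes "dual_bases I b c" "bilinear br"
  shows "ad_bivector br x (wedge y z) = wedge (br x y) z + wedge y (br x z)"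
  unfolding ad_bivector_def by (rule wedge_lift_wedge[OF assms(1) alternating_ad[OF assms(2)]])

lemma linear_ad_bivector:
  fixes b :: "'i \<Rightarrow> 'v::real_normed_vector"
    and br :: "'v \<Rightarrow> 'v \<Rightarrow> 'v"
  assumes "dual_bases I b c" "bilinear br"
  shows "linear (ad_bivector br x)"
  unfolding ad_bivector_def by (rule linear_wedge_lift[OF assms(1) alternating_ad[OF assms(2)]])

lemma alternating_schouten:
  assumes "bilinear br"
  defines "S \<equiv> \<lambda>X1 X2 Y1 Y2. wedge3 (br X1 Y1) X2 Y2 - wedge3 (br X1 Y2) X2 Y1
    - wedge3 (br X2 Y1) X1 Y2 + wedge3 (br X2 Y2) X1 Y1"
  shows "alternating_bilinear (S X1 X2)" and "alternating_bilinear (\<lambda>X1 X2. S X1 X2 Y1 Y2)"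
  unfolding alternating_bilinear_def bilinear_def S_def
  by (auto intro!: linearI trivector_eqI
      simp: wedge3_apply bilinear_radd[OF assms(1)] bilinear_rmul[OF assms(1)]
        bilinear_ladd[OF assms(1)] bilinear_lmul[OF assms(1)] blinfun.add_left blinfun.diff_left
        blinfun.scaleR_left blinfun.add_right blinfun.scaleR_right algebra_simps)

lemma alternating_lift_param:
  fixes b :: "'i \<Rightarrow> 'v::real_normed_vector" and h :: "'u::real_vector \<Rightarrow> 'u \<Rightarrow> 'v \<Rightarrow> 'v \<Rightarrow> 'w::real_vector"
  assumes D: "dual_bases I b c" and h: "\<And>x y. alternating_bilinear (h x y)"
    and h': "\<And>u v. alternating_bilinear (\<lambda>x y. h x y u v)" and s: "s \<in> bivectors"
  shows "alternating_bilinear (\<lambda>x y. wedge_lift (h x y) s)"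
proof -
  note lin = linear_wedge_lift[OF D h] and ap = wedge_lift_wedge[OF D h]
  have b: "bilinear (\<lambda>x y. h x y u v)" and a: "h x x u v = 0" for u v x
    using h' by (auto simp: alternating_bilinear_def)
  have "wedge_lift (h (x + x') y) s = wedge_lift (h x y) s + wedge_lift (h x' y) s" for x x' y
    by (rule linear_eq_on_bivectors[OF _ _ _ s, where L = "wedge_lift (h (x + x') y)" and L' = "\<lambda>s. wedge_lift (h x y) s + wedge_lift (h x' y) s"])
       (auto intro!: lin linear_compose_add simp: ap bilinear_ladd[OF b])
  moreover have "wedge_lift (h x (y + y')) s = wedge_lift (h x y) s + wedge_lift (h x y') s" for x y' y
    by (rule linear_eq_on_bivectors[OF _ _ _ s, where L = "wedge_lift (h x (y + y'))" and L' = "\<lambda>s. wedge_lift (h x y) s + wedge_lift (h x y') s"])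
       (auto intro!: lin linear_compose_add simp: ap bilinear_radd[OF b])
  moreover have "wedge_lift (h (k *\<^sub>R x) y) s = k *\<^sub>R wedge_lift (h x y) s" for x y k
    by (rule linear_eq_on_bivectors[OF _ _ _ s, where L = "wedge_lift (h (k *\<^sub>R x) y)" and L' = "\<lambda>s. k *\<^sub>R wedge_lift (h x y) s"])
       (auto intro!: lin linear_compose_scale_right simp: ap bilinear_lmul[OF b])
  moreover have "wedge_lift (h x (k *\<^sub>R y)) s = k *\<^sub>R wedge_lift (h x y) s" for x y k
    by (rule linear_eq_on_bivectors[OF _ _ _ s, where L = "wedge_lift (h x (k *\<^sub>R y))" and L' = "\<lambda>s. k *\<^sub>R wedge_lift (h x y) s"])
       (auto intro!: lin linear_compose_scale_right simp: ap bilinear_rmul[OF b])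
  moreover have "wedge_lift (h x x) s = 0" for x
    by (rule linear_eq_on_bivectors[OF _ _ _ s, where L = "wedge_lift (h x x)" and L' = "\<lambda>s. 0"])
       (auto intro!: lin module_hom_zero simp: ap a)
  ultimately show ?thesis
    unfolding alternating_bilinear_def bilinear_def by (auto intro!: linearI)
qed

lemma schouten_wedge:
  fixes b :: "'i \<Rightarrow> 'v::real_normed_vector"
    and br :: "'v \<Rightarrow> 'v \<Rightarrow> 'v"
  assumes D: "dual_bases I b c" and br: "bilinear br"
  shows "schouten br (wedge X1 X2) (wedge Y1 Y2) =
     wedge3 (br X1 Y1) X2 Y2 - wedge3 (br X1 Y2) X2 Y1
   - wedge3 (br X2 Y1) X1 Y2 + wedge3 (br X2 Y2) X1 Y1"
  unfolding schouten_def
  by (subst wedge_lift_wedge[OF D], rule alternating_lift_param[OF D alternating_schouten[OF br]],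
      rule wedge_in_bivectors, rule wedge_lift_wedge[OF D alternating_schouten(1)[OF br]])

lemma linear_schouten_left:
  fixes b :: "'i \<Rightarrow> 'v::real_normed_vector"
    and br :: "'v \<Rightarrow> 'v \<Rightarrow> 'v"
  assumes D: "dual_bases I b c" and br: "bilinear br" and s: "s \<in> bivectors"
  shows "linear (\<lambda>r. schouten br r s)"
  unfolding schouten_def
  by (rule linear_wedge_lift[OF D alternating_lift_param[OF D alternating_schouten[OF br] s]])

lemma linear_schouten_right:
  fixes b :: "'i \<Rightarrow> 'v::real_normed_vector"
    and br :: "'v \<Rightarrow> 'v \<Rightarrow> 'v"
  assumes D: "dual_bases I b c" and br: "bilinear br"
    and r: "r \<in> bivectors" and s: "s \<in> bivectors" "s' \<in> bivectors"
  shows "schouten br r (s + s') = schouten br r s + schouten br r s'"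
    and "schouten br r (k *\<^sub>R s) = k *\<^sub>R schouten br r s"
proof -
  note lin = linear_schouten_left[OF D br]
  have sub: "s + s' \<in> bivectors" "k *\<^sub>R s \<in> bivectors"
    using s by (auto simp: bivectors_def intro: span_add span_scale)
  have w: "schouten br (wedge x y) t =
      wedge_lift (\<lambda>Y1 Y2. wedge3 (br x Y1) y Y2 - wedge3 (br x Y2) y Y1
        - wedge3 (br y Y1) x Y2 + wedge3 (br y Y2) x Y1) t" if "t \<in> bivectors" for x y t
    unfolding schouten_def
    by (rule wedge_lift_wedge[OF D alternating_lift_param[OF D alternating_schouten[OF br] that]])
  note l2 = linear_wedge_lift[OF D alternating_schouten(1)[OF br]]
  show "schouten br r (s + s') = schouten br r s + schouten br r s'"
    by (rule linear_eq_on_bivectors[OF _ _ _ r, where L = "\<lambda>r. schouten br r (s + s')"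
          and L' = "\<lambda>r. schouten br r s + schouten br r s'"])
       (use s sub in \<open>auto intro!: lin linear_compose_add simp: w linear_add[OF l2]\<close>)
  show "schouten br r (k *\<^sub>R s) = k *\<^sub>R schouten br r s"
    by (rule linear_eq_on_bivectors[OF _ _ _ r, where L = "\<lambda>r. schouten br r (k *\<^sub>R s)"
          and L' = "\<lambda>r. k *\<^sub>R schouten br r s"])
       (use s sub in \<open>auto intro!: lin linear_compose_scale_right simp: w linear_cmul[OF l2]\<close>)
qed

lemma bivector_skew:
  assumes "\<omega> \<in> bivectors"
  shows "\<omega> \<beta> \<alpha> = - \<omega> \<alpha> \<beta>"
  by (rule linear_eq_on_bivectors[OF _ _ _ assms, where L = "\<lambda>\<omega>. \<omega> \<beta> \<alpha>" and L' = "\<lambda>\<omega>. - \<omega> \<alpha> \<beta>"])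
     (auto intro!: linearI simp: blinfun.add_left blinfun.scaleR_left wedge_apply)

lemma bivector_pairing_eq:
  fixes b :: "'i \<Rightarrow> 'v::real_normed_vector"
    and \<omega> :: "'v bivector"
  assumes D: "dual_bases I b c" and w: "\<omega> \<in> bivectors"
  shows "bivector_pairing (wedge \<alpha> \<beta>) \<omega> = \<omega> \<alpha> \<beta>"
    and "linear (\<lambda>\<phi>. bivector_pairing \<phi> \<omega>)"
proof -
  have alt: "alternating_bilinear (\<lambda>x y. \<alpha> x * \<beta> y - \<alpha> y * \<beta> x)" for \<alpha> \<beta> :: "'v dual"
    unfolding alternating_bilinear_def bilinear_def
    by (auto intro!: linearI simp: blinfun.add_right blinfun.scaleR_right algebra_simps)
  have eq: "wedge_lift (\<lambda>x y. \<alpha> x * \<beta> y - \<alpha> y * \<beta> x) \<omega> = \<omega> \<alpha> \<beta>" for \<alpha> \<beta> :: "'v dual"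
    by (rule linear_eq_on_bivectors[OF _ _ _ w, where L' = "\<lambda>\<omega>. \<omega> \<alpha> \<beta>"])
       (auto intro!: linearI linear_wedge_lift[OF D alt]
         simp: wedge_lift_wedge[OF D alt] blinfun.add_left blinfun.scaleR_left wedge_apply)
  have "\<omega> \<alpha> \<alpha> = 0" for \<alpha>
    using bivector_skew[OF w, of \<alpha> \<alpha>] by linarith
  then have "alternating_bilinear (\<lambda>\<alpha> \<beta>. \<omega> \<alpha> \<beta>)"
    unfolding alternating_bilinear_def bilinear_def
    by (auto intro!: linearI simp: blinfun.add_right blinfun.scaleR_right blinfun.add_left
        blinfun.scaleR_left)
  then show "bivector_pairing (wedge \<alpha> \<beta>) \<omega> = \<omega> \<alpha> \<beta>" "linear (\<lambda>\<phi>. bivector_pairing \<phi> \<omega>)"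
    unfolding bivector_pairing_def eq
    by (rule wedge_lift_wedge[OF dual_bases_dual[OF D]] linear_wedge_lift[OF dual_bases_dual[OF D]])+
qed

lemma bivector_pairing_wedge:
  fixes b :: "'i \<Rightarrow> 'v::real_normed_vector"
    and \<alpha> \<beta> :: "'v dual"
  assumes "dual_bases I b c"
  shows "bivector_pairing (wedge \<alpha> \<beta>) (wedge x y) = \<alpha> x * \<beta> y - \<alpha> y * \<beta> x"
  by (simp add: bivector_pairing_eq[OF assms wedge_in_bivectors] wedge_apply)

lemma bivector_pairing_wedge_right:
  fixes b :: "'i \<Rightarrow> 'v::real_normed_vector"
    and \<phi> :: "'v dual bivector"
  assumes D: "dual_bases I b c" and p: "\<phi> \<in> bivectors"
  shows "bivector_pairing \<phi> (wedge x y) = \<phi> (evaluation x) (evaluation y)"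
  by (rule linear_eq_on_bivectors[OF _ _ _ p, where L = "\<lambda>\<phi>. bivector_pairing \<phi> (wedge x y)"])
     (auto intro!: linearI bivector_pairing_eq(2)[OF D wedge_in_bivectors]
       simp: bivector_pairing_wedge[OF D] blinfun.add_left blinfun.scaleR_left wedge_apply)

lemma bivector_dual_eqI:
  fixes b :: "'i \<Rightarrow> 'v::real_normed_vector"
    and \<phi> \<phi>' :: "'v dual bivector"
  assumes D: "dual_bases I b c"
    and e: "\<And>x y. \<phi> (evaluation x) (evaluation y) = \<phi>' (evaluation x) (evaluation y)"
  shows "\<phi> = \<phi>'"
proof (rule bivector_eqI)
  fix \<Phi> \<Psi> :: "'v dual dual"
  note D2 = dual_bases_dual[OF dual_bases_dual[OF D]]
  have bil: "bilinear (\<lambda>\<Phi> \<Psi>. \<phi> \<Phi> \<Psi>)" for \<phi> :: "'v dual bivector"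
    unfolding bilinear_def
    by (auto intro!: linearI simp: blinfun.add_right blinfun.scaleR_right blinfun.add_left
        blinfun.scaleR_left)
  show "\<phi> \<Phi> \<Psi> = \<phi>' \<Phi> \<Psi>"
    using bilinear_expand[OF D2 bil, of \<phi> \<Phi> \<Psi>] bilinear_expand[OF D2 bil, of \<phi>' \<Phi> \<Psi>]
    by (simp only: e)
qed

lemma dual_cocycle_ex1:
  fixes br :: "'v::real_normed_vector \<Rightarrow> 'v \<Rightarrow> 'v" and b :: "'i \<Rightarrow> 'v"
    and \<alpha> :: "'v dual"
  assumes D: "dual_bases I b c" and br: "alternating_bilinear br"
  shows "\<exists>!\<phi>. \<phi> \<in> bivectors \<and> (\<forall>x y. bivector_pairing \<phi> (wedge x y) = \<alpha> (br x y))"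
proof (rule ex_ex1I)
  define \<phi> where "\<phi> = (\<Sum>i\<in>I. \<Sum>j\<in>I. (\<alpha> (br (b i) (b j)) / 2) *\<^sub>R wedge (c i) (c j))"
  have b: "bilinear br" using br by (simp add: alternating_bilinear_def)
  have bil: "bilinear (\<lambda>x y. \<alpha> (br x y))"
    unfolding bilinear_def
    by (auto intro!: linearI simp: bilinear_ladd[OF b] bilinear_radd[OF b] bilinear_lmul[OF b]
        bilinear_rmul[OF b] blinfun.add_right blinfun.scaleR_right)
  have p: "\<phi> \<in> bivectors"
    unfolding \<phi>_def bivectors_def
    by (intro span_sum span_scale span_base) blast
  have "bivector_pairing \<phi> (wedge x y) = \<alpha> (br x y)" for x y
  proof -
    have "bivector_pairing \<phi> (wedge x y) = \<phi> (evaluation x) (evaluation y)"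
      by (rule bivector_pairing_wedge_right[OF D p])
    also have "\<dots> = (\<alpha> (br x y) - \<alpha> (br y x)) / 2"
      unfolding bilinear_expand[OF D bil, of x y] bilinear_expand[OF D bil, of y x] \<phi>_def
      by (simp add: blinfun.sum_left blinfun.scaleR_left wedge_apply algebra_simps
          sum_subtractf diff_divide_distrib sum_divide_distrib)
    also have "\<dots> = \<alpha> (br x y)"
      by (simp add: alternating_swap[OF br, of y x] blinfun.minus_right)
    finally show ?thesis .
  qed
  with p show "\<exists>\<phi>. \<phi> \<in> bivectors \<and> (\<forall>x y. bivector_pairing \<phi> (wedge x y) = \<alpha> (br x y))"
    by blast
next
  fix \<phi> \<phi>' :: "'v dual bivector"
  assume "\<phi> \<in> bivectors \<and> (\<forall>x y. bivector_pairing \<phi> (wedge x y) = \<alpha> (br x y))"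
    "\<phi>' \<in> bivectors \<and> (\<forall>x y. bivector_pairing \<phi>' (wedge x y) = \<alpha> (br x y))"
  then show "\<phi> = \<phi>'"
    by (intro bivector_dual_eqI[OF D]) (metis bivector_pairing_wedge_right[OF D])
qed

lemma dual_bracket_apply:
  fixes \<xi> :: "'v::euclidean_space \<Rightarrow> 'v bivector"
  assumes "linear \<xi>" "\<And>x. \<xi> x \<in> bivectors"
  shows "dual_bracket \<xi> \<alpha> \<beta> x = \<xi> x \<alpha> \<beta>"
proof -
  have "linear (\<lambda>x. \<xi> x \<alpha> \<beta>)"
    using assms(1) by (auto intro!: linearI simp: linear_add linear_cmul blinfun.add_left blinfun.scaleR_left)
  then show ?thesis
    unfolding dual_bracket_def bivector_pairing_eq(1)[OF dual_bases_euclidean assms(2)]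
    by (simp add: linear_conv_bounded_linear bounded_linear_Blinfun_apply)
qed

lemma bij_blinfun_inner_right: "bij (blinfun_inner_right :: 'v::euclidean_space \<Rightarrow> _)"
proof (rule bijI)
  show "inj (blinfun_inner_right :: 'v \<Rightarrow> _)"
  proof (rule injI)
    fix x y :: 'v
    assume "blinfun_inner_right x = blinfun_inner_right y"
    then have "x \<bullet> z = y \<bullet> z" for z by (metis blinfun_inner_right.rep_eq)
    then show "x = y" by (metis vector_eq_rdot)
  qed
  show "surj (blinfun_inner_right :: 'v \<Rightarrow> _)"
  proof (rule surjI, rule blinfun_eqI)
    fix \<alpha> :: "'v dual" and x
    have "\<alpha> x = \<alpha> (\<Sum>b\<in>Basis. (x \<bullet> b) *\<^sub>R b)" by (simp add: euclidean_representation)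
    then show "blinfun_inner_right (\<Sum>b\<in>Basis. \<alpha> b *\<^sub>R b) x = \<alpha> x"
      by (simp add: blinfun.sum_right blinfun.scaleR_right inner_sum_left inner_commute[of x] mult.commute)
  qed
qed

lemma dual_inner_sharp: "dual_inner (blinfun_inner_right x) (blinfun_inner_right y) = x \<bullet> y"
  by (simp add: dual_inner_def inv_f_f[OF bij_is_inj[OF bij_blinfun_inner_right]])

lemma levi_civita_koszul:
  assumes br: "bilinear br" and ip: "scalar_product ip"
    and rep: "\<And>f. linear f \<Longrightarrow> \<exists>v. \<forall>z. ip v z = f z"
  shows "2 * ip (levi_civita br ip x y) z = ip (br x y) z + ip (br z x) y + ip (br z y) x"
proof -
  have b: "bilinear ip" and pos: "\<And>x. x \<noteq> 0 \<Longrightarrow> ip x x > 0"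
    using ip by (auto simp: scalar_product_def)
  have "linear (\<lambda>z. (ip (br x y) z + ip (br z x) y + ip (br z y) x) / 2)"
    by (rule linearI)
       (simp_all add: bilinear_ladd[OF b] bilinear_radd[OF b] bilinear_lmul[OF b] bilinear_rmul[OF b]
         bilinear_ladd[OF br] bilinear_lmul[OF br] add_divide_distrib distrib_left)
  from rep[OF this] obtain v where
    v': "\<forall>z. ip v z = (ip (br x y) z + ip (br z x) y + ip (br z y) x) / 2" ..
  have v: "\<forall>z. 2 * ip v z = ip (br x y) z + ip (br z x) y + ip (br z y) x"
    by (simp add: v')
  moreover have "v' = v"
    if "\<forall>z. 2 * ip v' z = ip (br x y) z + ip (br z x) y + ip (br z y) x" for v'
  proof -
    have "2 * ip v' z = 2 * ip v z" for z using that v by simp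
    then have "ip (v' - v) (v' - v) = 0"
      by (simp add: bilinear_lsub[OF b])
    then show ?thesis using pos[of "v' - v"] by fastforce
  qed
  ultimately have "levi_civita br ip x y = v"
    unfolding levi_civita_def by (intro the_equality)
  then show ?thesis using v by simp
qed

lemma inner_represents:
  fixes f :: "'v::euclidean_space \<Rightarrow> real"
  assumes "linear f"
  shows "\<exists>v. \<forall>z. v \<bullet> z = f z"
proof -
  have "bounded_linear f" using assms by (simp add: linear_conv_bounded_linear)
  moreover obtain v where "Blinfun f = blinfun_inner_right v"
    using bij_is_surj[OF bij_blinfun_inner_right] by (metis surjD)
  ultimately show ?thesis
    by (metis blinfun_inner_right.rep_eq bounded_linear_Blinfun_apply)
qed

lemma dual_inner_represents:
  fixes f :: "'v::euclidean_space dual \<Rightarrow> real"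
  assumes "linear f"
  shows "\<exists>\<alpha>. \<forall>\<beta>. dual_inner \<alpha> \<beta> = f \<beta>"
proof -
  have "linear (\<lambda>x. f (blinfun_inner_right x))"
    using linear_compose[OF bounded_linear.linear[OF bounded_linear_blinfun_inner_right] assms]
    by (simp add: o_def)
  from inner_represents[OF this] obtain v where "\<forall>z. v \<bullet> z = f (blinfun_inner_right z)" by blast
  then show ?thesis
    using dual_inner_sharp surjD[OF bij_is_surj[OF bij_blinfun_inner_right]] by metis
qed

end

theory Submission
  imports Defs
begin

text \<open>
  Let \<open>D\<close> be the Levi-Civita product of the flat Lie algebra. Everything rests on two identities,
  \<open>D (D x y) z = 0\<close> and \<open>D x (D y z) = D y (D x z)\<close>, a form of Milnor's theorem. They are obtained from
  a Casimir argument: on the orthogonal complement of \<open>{x. D x = 0}\<close> the trace form is definite, and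
  there the identity map is a 1-cocycle for \<open>D\<close> (\<open>D_eq_0_orthogonal_flat_kernel\<close>, \<open>D_D_left_eq_0\<close>).

  Through the inner product \<open>r\<close> becomes a skew operator \<open>R\<close>. For \<open>x\<close> orthogonal to
  \<open>{x. D x = 0}\<close>, which puts \<open>x\<close> into the summand \<open>s\<close>, the adjoint action on bivectors is the
  commutator with the skew operator \<open>D x\<close>. The metaflat condition makes the triple commutator of \<open>D x\<close>
  with \<open>R\<close> vanish, and since taking commutators with a skew operator is a semisimple operation,
  \<open>R\<close> commutes with \<open>D x\<close> itself, and then with every \<open>D x\<close> (\<open>bivector_operator_commutes\<close>).

  All assertions follow from this commutation. The product \<open>R D (R b)\<close> is symmetric, which makes the
  Schouten bracket cancel (\<open>schouten_eq_0\<close>). The dual bracket is the commutator of the product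
  \<open>(a, b) \<mapsto> D (R a) b\<close>, which again satisfies the two identities and is therefore the Levi-Civita
  product of a flat metric (\<open>flat_lie_algebra_of_commuting_skew\<close>, \<open>flat_dual\<close>). The dual cocycle
  vanishes on the summand \<open>s\<close> of the dual algebra, so that the dual is metaflat (\<open>metaflat_dual\<close>).
  That the dual cocycle is a cocycle at all is the self-duality of Lie bialgebras
  (\<open>lie_bialgebra_dual\<close>).
\<close>

section \<open>Skew operators and orthonormal frames\<close>

definition operator_trace :: "('v::euclidean_space \<Rightarrow> 'v) \<Rightarrow> real" where
  "operator_trace f = (\<Sum>i\<in>Basis. f i \<bullet> i)"

lemma operator_trace_commute:
  fixes f g :: "'v::euclidean_space \<Rightarrow> 'v"
  assumes f: "linear f" and g: "linear g"
  shows "operator_trace (\<lambda>x. f (g x)) = operator_trace (\<lambda>x. g (f x))"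
proof -
  have e: "h (k i) \<bullet> i = (\<Sum>j\<in>Basis. (k i \<bullet> j) * (h j \<bullet> i))"
    if "linear h" for h k :: "'v \<Rightarrow> 'v" and i
  proof -
    have "h (k i) = h (\<Sum>j\<in>Basis. (k i \<bullet> j) *\<^sub>R j)" by (simp add: euclidean_representation)
    then show ?thesis by (simp add: linear_sum[OF that] linear_cmul[OF that] inner_sum_left)
  qed
  show ?thesis
    unfolding operator_trace_def e[OF f, of g] e[OF g, of f]
    by (subst sum.swap) (simp add: mult.commute)
qed

lemma operator_trace_diff:
  "operator_trace (\<lambda>x. f x - g x) = operator_trace f - operator_trace g"
  by (simp add: operator_trace_def inner_diff_left sum_subtractf)

definition skew_operator :: "('v::real_inner \<Rightarrow> 'v) \<Rightarrow> bool" where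
  "skew_operator f \<longleftrightarrow> linear f \<and> (\<forall>x y. f x \<bullet> y = - (x \<bullet> f y))"

lemma operator_trace_skew_square:
  assumes "skew_operator f"
  shows "operator_trace (\<lambda>x. f (f x)) = - (\<Sum>i\<in>Basis. (norm (f i))\<^sup>2)"
  using assms by (simp add: operator_trace_def skew_operator_def sum_negf power2_norm_eq_inner)

lemma skew_operator_eq_0:
  assumes f: "skew_operator f" and "operator_trace (\<lambda>x. f (f x)) = 0"
  shows "f x = 0"
proof -
  have "(\<Sum>i\<in>Basis. (norm (f i))\<^sup>2) = 0"
    using assms(2) unfolding operator_trace_skew_square[OF f] by simp
  then have "f i = 0" if "i \<in> Basis" for i
    using that by (simp add: sum_nonneg_eq_0_iff)
  then show ?thesis
    using linear_eq_on[OF _ linear_zero, of f x Basis] f by (simp add: skew_operator_def)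
qed

lemma skew_operator_commutator:
  assumes "skew_operator f" "skew_operator g"
  shows "skew_operator (\<lambda>x. f (g x) - g (f x))"
proof -
  have l: "linear f" "linear g" and s: "f x \<bullet> y = - (x \<bullet> f y)" "g x \<bullet> y = - (x \<bullet> g y)" for x y
    using assms by (auto simp: skew_operator_def)
  have "linear (\<lambda>x. f (g x) - g (f x))"
    using linear_compose_sub[OF linear_compose[OF l(2,1)] linear_compose[OF l]] by (simp add: o_def)
  then show ?thesis
    by (simp add: skew_operator_def inner_diff_left inner_diff_right s)
qed

text \<open>
  With \<open>M = [A, N]\<close>, cyclicity of the trace turns \<open>tr M\<^sup>2\<close> into \<open>tr N [M, A]\<close>, which vanishes as
  soon as \<open>M\<close> commutes with \<open>A\<close>; but \<open>- tr M\<^sup>2\<close> is the squared Frobenius norm of the skew operator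
  \<open>M\<close>. In other words \<open>ad\<^sub>A\<close> is skew on the space of skew operators, so that the kernel of its square
  is its kernel.
\<close>

lemma skew_square_commutator_eq_0:
  fixes A N :: "'v::euclidean_space \<Rightarrow> 'v"
  defines "M \<equiv> \<lambda>x. A (N x) - N (A x)"
  assumes A: "skew_operator A" and N: "skew_operator N"
    and c: "\<And>x. A (M x) = M (A x)"
  shows "M x = 0"
proof -
  have M: "skew_operator M"
    unfolding M_def by (rule skew_operator_commutator[OF A N])
  have l: "linear A" "linear N" "linear M"
    using A N M by (auto simp: skew_operator_def)
  have "operator_trace (\<lambda>x. M (M x))
      = operator_trace (\<lambda>x. A (N (M x))) - operator_trace (\<lambda>x. N (A (M x)))"
    by (subst (1) M_def) (rule operator_trace_diff)
  also have "operator_trace (\<lambda>x. A (N (M x))) = operator_trace (\<lambda>x. N (M (A x)))"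
    by (rule operator_trace_commute[OF l(1) linear_compose[OF l(3,2), unfolded o_def]])
  finally have "operator_trace (\<lambda>x. M (M x)) = 0" by (simp add: c)
  then show ?thesis by (rule skew_operator_eq_0[OF M])
qed

text \<open>
  Gram-Schmidt for a form that is definite only on \<open>S\<close>. It is applied to the trace form of a
  representation, which is unrelated to the inner product of the ambient space.
\<close>

lemma orthonormal_frame_exists:
  fixes B :: "'v::euclidean_space \<Rightarrow> 'v \<Rightarrow> real"
  assumes S: "subspace S" and B: "bilinear B" and sym: "\<And>x y. B x y = B y x"
    and pos: "\<And>x. x \<in> S \<Longrightarrow> x \<noteq> 0 \<Longrightarrow> B x x > 0"
  obtains E where "finite E" "E \<subseteq> S"
    "\<And>e f. e \<in> E \<Longrightarrow> f \<in> E \<Longrightarrow> B e f = (if e = f then 1 else 0)"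
    "\<And>x. x \<in> S \<Longrightarrow> (\<Sum>e\<in>E. B x e *\<^sub>R e) = x"
proof -
  note lin = bilinear_ladd[OF B] bilinear_lmul[OF B] bilinear_lsub[OF B] bilinear_lzero[OF B]
    bilinear_radd[OF B] bilinear_rmul[OF B] bilinear_rsub[OF B]
  have lsum: "B (\<Sum>e\<in>E. g e *\<^sub>R e) y = (\<Sum>e\<in>E. g e * B e y)" if "finite E" for E g y
    using that by induction (simp_all add: lin)
  define orthonormal where
    "orthonormal E \<longleftrightarrow> (\<forall>e\<in>E. \<forall>f\<in>E. B e f = (if e = f then 1 else 0))" for E
  define expands where "expands E x \<longleftrightarrow> (\<Sum>e\<in>E. B x e *\<^sub>R e) = x" for E x
  obtain F where F: "independent F" "F \<subseteq> S" "S \<subseteq> span F" "finite F"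
    by (rule maximal_independent_subset[of S]) (metis independent_imp_finite)
  have "\<exists>E. finite E \<and> E \<subseteq> S \<and> orthonormal E \<and> (\<forall>x\<in>F. expands E x)"
    using F(4,2)
  proof (induction F rule: finite_induct)
    case empty
    show ?case by (intro exI[of _ "{}"]) (simp add: orthonormal_def)
  next
    case (insert a F)
    then obtain E where E: "finite E" "E \<subseteq> S" "orthonormal E" "\<forall>x\<in>F. expands E x"
      by blast
    define a' where "a' = a - (\<Sum>e\<in>E. B a e *\<^sub>R e)"
    have a_eq: "a = (\<Sum>e\<in>E. B a e *\<^sub>R e) + a'" by (simp add: a'_def)
    show ?case
    proof (cases "a' = 0")
      case True
      then have "expands E a" by (simp add: a'_def expands_def)
      then show ?thesis using E by blast
    next
      case False
      have a'S: "a' \<in> S"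
        unfolding a'_def using insert.prems E(2) S
        by (intro subspace_diff subspace_sum subspace_scale) auto
      have orth: "B a' e = 0" "B e a' = 0" if "e \<in> E" for e
      proof -
        have "(\<Sum>f\<in>E. B a f * B f e) = (\<Sum>f\<in>E. if f = e then B a e else 0)"
          using E(3) that by (intro sum.cong) (auto simp: orthonormal_def)
        then show "B a' e = 0" using that E(1) by (simp add: a'_def lin lsum)
        then show "B e a' = 0" by (simp add: sym)
      qed
      define n where "n = sqrt (B a' a')"
      have n: "n > 0" "B a' a' = n * n" using pos[OF a'S False] by (auto simp: n_def)
      define u where "u = (1 / n) *\<^sub>R a'"
      have uu: "B u u = 1" using n by (simp add: u_def lin)
      have ue: "B u e = 0" "B e u = 0" if "e \<in> E" for e
        using orth[OF that] by (simp_all add: u_def lin)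
      have uE: "u \<notin> E" using ue uu by force
      have "orthonormal (insert u E)"
        using E(3) ue uu uE by (auto simp: orthonormal_def)
      moreover have "insert u E \<subseteq> S" using E(2) a'S S by (simp add: u_def subspace_scale)
      moreover have "expands (insert u E) a"
      proof -
        have "B a a' = n * n"
          by (subst a_eq) (use E(1) n in \<open>simp add: lin lsum orth\<close>)
        then have "B a u *\<^sub>R u = a'" using n(1) by (simp add: u_def lin)
        then show ?thesis using E(1) uE by (simp add: expands_def a'_def)
      qed
      moreover have "expands (insert u E) x" if "x \<in> F" for x
      proof -
        have x: "(\<Sum>e\<in>E. B x e *\<^sub>R e) = x" using E(4) that by (simp add: expands_def)
        have "B (\<Sum>e\<in>E. B x e *\<^sub>R e) u = 0" using E(1) ue by (simp add: lsum)
        then show ?thesis using E(1) uE x by (simp add: expands_def)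
      qed
      ultimately show ?thesis using E(1) by blast
    qed
  qed
  then obtain E where E: "finite E" "E \<subseteq> S" "orthonormal E" "\<And>x. x \<in> F \<Longrightarrow> expands E x"
    by blast
  have expand: "(\<Sum>e\<in>E. B x e *\<^sub>R e) = x" if "x \<in> S" for x
  proof (rule linear_eq_on[where B = F, of _ "\<lambda>x. x"])
    show "linear (\<lambda>x. \<Sum>e\<in>E. B x e *\<^sub>R e)"
      by (rule linearI) (simp_all add: lin scaleR_add_left sum.distrib scaleR_sum_right)
    show "x \<in> span F" using that F(3) by blast
  qed (use E(4) in \<open>auto intro: linear_ident simp: expands_def\<close>)
  have "B e f = (if e = f then 1 else 0)" if "e \<in> E" "f \<in> E" for e f
    using E(3) that by (simp add: orthonormal_def)
  from that[OF E(1,2) this expand] show thesis .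
qed

section \<open>Flat connections and Milnor's theorem\<close>

text \<open>
  The Levi-Civita product of a flat Lie algebra, taken as the primitive notion: the bracket is
  recovered from it as \<open>D x y - D y x\<close>, because the torsion vanishes.
\<close>

locale flat_connection =
  fixes D :: "'v::euclidean_space \<Rightarrow> 'v \<Rightarrow> 'v"
  assumes bilin: "bilinear D"
    and metric: "D x y \<bullet> z = - (y \<bullet> D x z)"
    and flat: "D (D x y - D y x) z = D x (D y z) - D y (D x z)"
begin

lemmas lin_simps =
  bilinear_ladd[OF bilin] bilinear_lmul[OF bilin] bilinear_lsub[OF bilin] bilinear_lzero[OF bilin]
  bilinear_radd[OF bilin] bilinear_rmul[OF bilin] bilinear_rsub[OF bilin] bilinear_rzero[OF bilin]

lemma linear_right: "linear (D x)" and linear_left: "linear (\<lambda>x. D x y)"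
  using bilin by (auto simp: bilinear_def)

lemma skew_operator_D: "skew_operator (D x)"
  by (simp add: skew_operator_def linear_right metric)

lemma metric_self: "y \<bullet> D x y = 0"
  using metric[of x y y] by (simp add: inner_commute)

definition bracket :: "'v \<Rightarrow> 'v \<Rightarrow> 'v" where
  "bracket x y = D x y - D y x"

lemma alternating_bracket: "alternating_bilinear bracket"
  unfolding alternating_bilinear_def bilinear_def bracket_def
  by (auto intro!: linearI simp: lin_simps algebra_simps)

lemma bilinear_bracket: "bilinear bracket"
  using alternating_bracket by (simp add: alternating_bilinear_def)

definition flat_kernel :: "'v set" where
  "flat_kernel = {x. \<forall>y. D x y = 0}"

lemma subspace_flat_kernel: "subspace flat_kernel"
  unfolding flat_kernel_def by (auto simp: subspace_def lin_simps)

lemma flat_kernel_split: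
  obtains p q where "p \<in> flat_kernel" "\<And>k. k \<in> flat_kernel \<Longrightarrow> q \<bullet> k = 0" "x = p + q"
  using orthogonal_subspace_decomp_exists[of flat_kernel x] subspace_flat_kernel
  by (metis orthogonal_def span_eq_iff)

text \<open>
  For \<open>x\<close> in the kernel of \<open>D\<close> the vector \<open>D y x\<close> is the bracket of \<open>y\<close> and \<open>x\<close>, and \<open>D\<close> is a
  homomorphism of Lie algebras. Since each \<open>D y\<close> is skew, the orthogonal complement of the kernel is
  preserved as well.
\<close>

lemma D_flat_kernel: "x \<in> flat_kernel \<Longrightarrow> D y x \<in> flat_kernel"
  using flat[of y x] by (simp add: flat_kernel_def lin_simps)

lemma D_orthogonal_flat_kernel:
  assumes "\<And>k. k \<in> flat_kernel \<Longrightarrow> x \<bullet> k = 0" "k \<in> flat_kernel"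
  shows "D y x \<bullet> k = 0"
  using assms D_flat_kernel by (simp add: metric)

text \<open>
  This is the heart of Milnor's theorem on flat left-invariant metrics. The complement \<open>S\<close> of the
  kernel is a Lie subalgebra on which the trace form \<open>- tr (D x D y)\<close> is positive definite and
  invariant. The identity map of \<open>S\<close> is a 1-cocycle for the representation \<open>D\<close>, by vanishing of the
  torsion, and the usual Casimir argument for Whitehead's lemma produces a vector \<open>w\<close> with
  \<open>D x w = C x\<close>, where \<open>C\<close> is the (negative semidefinite) Casimir operator. Skewness of \<open>D w\<close> makes
  \<open>\<langle>C w, w\<rangle> = \<langle>D w w, w\<rangle>\<close> zero, so all \<open>D x\<close> kill \<open>w\<close>, whence \<open>C = 0\<close> on \<open>S\<close>, and then every
  \<open>D x\<close> vanishes on \<open>S\<close>.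
\<close>

lemma D_eq_0_orthogonal_flat_kernel:
  assumes x: "\<And>k. k \<in> flat_kernel \<Longrightarrow> x \<bullet> k = 0"
    and y: "\<And>k. k \<in> flat_kernel \<Longrightarrow> y \<bullet> k = 0"
  shows "D x y = 0"
proof -
  define S where "S = {x. \<forall>k\<in>flat_kernel. x \<bullet> k = 0}"
  have S: "subspace S" by (auto simp: S_def subspace_def inner_add_left)
  define B where "B = (\<lambda>x y. - operator_trace (\<lambda>z. D x (D y z)))"
  have B: "bilinear B"
    unfolding B_def bilinear_def
    by (auto intro!: linearI simp: operator_trace_def lin_simps inner_add_left sum.distrib sum_distrib_left)
  have sym: "B x y = B y x" for x y
    unfolding B_def by (simp add: operator_trace_commute[OF linear_right linear_right])
  have pos: "B x x > 0" if "x \<in> S" "x \<noteq> 0" for x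
  proof -
    have "B x x = (\<Sum>i\<in>Basis. (norm (D x i))\<^sup>2)"
      by (simp add: B_def operator_trace_skew_square[OF skew_operator_D])
    then have "B x x \<ge> 0" by (simp add: sum_nonneg)
    moreover have "B x x \<noteq> 0"
    proof
      assume "B x x = 0"
      then have "D x z = 0" for z
        by (intro skew_operator_eq_0[OF skew_operator_D]) (simp add: B_def)
      then have "x \<in> flat_kernel" by (simp add: flat_kernel_def)
      with that show False by (auto simp: S_def)
    qed
    ultimately show ?thesis by simp
  qed
  have inv: "B (D x y - D y x) z = - B (D x z - D z x) y" for x y z
  proof -
    have l: "linear (\<lambda>t. D x (D y t))" for x y
      using linear_compose[OF linear_right linear_right] by (simp add: o_def)
    have "operator_trace (\<lambda>t. D y (D x (D z t))) = operator_trace (\<lambda>t. D x (D z (D y t)))"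
      by (rule operator_trace_commute[OF linear_right l])
    moreover have "operator_trace (\<lambda>t. D x (D y (D z t))) = operator_trace (\<lambda>t. D z (D x (D y t)))"
      by (rule operator_trace_commute[OF linear_right l, symmetric])
    ultimately show ?thesis
      unfolding B_def flat by (simp add: operator_trace_diff)
  qed
  obtain E where E: "finite E" "E \<subseteq> S"
    "\<And>e f. e \<in> E \<Longrightarrow> f \<in> E \<Longrightarrow> B e f = (if e = f then 1 else 0)"
    "\<And>x. x \<in> S \<Longrightarrow> (\<Sum>e\<in>E. B x e *\<^sub>R e) = x"
    by (rule orthonormal_frame_exists[OF S B sym pos]) (assumption | rule that)+
  have DS: "D x y \<in> S" if "y \<in> S" for x y
    using that D_orthogonal_flat_kernel by (auto simp: S_def)
  define C where "C = (\<lambda>x. \<Sum>e\<in>E. D e (D e x))"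
  define w where "w = (\<Sum>e\<in>E. D e e)"
  have wS: "w \<in> S" unfolding w_def using E(2) by (auto intro!: subspace_sum[OF S] DS)
  have Dw: "D x w = C x" if xS: "x \<in> S" for x
  proof -
    define m where "m = (\<lambda>e f. B (D x e - D e x) f)"
    \<comment> \<open>The matrix of \<open>ad x\<close> on \<open>S\<close> in the frame \<open>E\<close> is skew, so the two correction terms cancel:
      this is the invariance of the Casimir element.\<close>
    have m: "m f e = - m e f" for e f unfolding m_def by (rule inv)
    have brk: "D x e - D e x = (\<Sum>f\<in>E. m e f *\<^sub>R f)" if "e \<in> E" for e
      unfolding m_def by (rule E(4)[symmetric]) (use that E(2) xS in \<open>auto intro!: subspace_diff[OF S] DS\<close>)
    have "D x (D e e) = D (D x e - D e x) e + D e (D x e - D e x) + D e (D e x)" for e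
      using flat[of x e e] by (simp add: lin_simps)
    then have "D x w = (\<Sum>e\<in>E. D (D x e - D e x) e) + (\<Sum>e\<in>E. D e (D x e - D e x)) + C x"
      by (simp only: w_def C_def linear_sum[OF linear_right] sum.distrib)
    moreover have "(\<Sum>e\<in>E. D (D x e - D e x) e) = (\<Sum>e\<in>E. \<Sum>f\<in>E. m e f *\<^sub>R D f e)"
      by (rule sum.cong) (simp_all add: brk linear_sum[OF linear_left] lin_simps)
    moreover have "(\<Sum>e\<in>E. D e (D x e - D e x)) = (\<Sum>e\<in>E. \<Sum>f\<in>E. m e f *\<^sub>R D e f)"
      by (rule sum.cong) (simp_all add: brk linear_sum[OF linear_right] lin_simps)
    moreover have "(\<Sum>e\<in>E. \<Sum>f\<in>E. m e f *\<^sub>R D f e) = - (\<Sum>e\<in>E. \<Sum>f\<in>E. m e f *\<^sub>R D e f)"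
      by (subst sum.swap) (subst m, simp add: sum_negf)
    ultimately show ?thesis by simp
  qed
  have C_0: "D e x = 0" if "C x \<bullet> x = 0" "e \<in> E" for e x
  proof -
    have "C x \<bullet> x = - (\<Sum>e\<in>E. (norm (D e x))\<^sup>2)"
      by (simp add: C_def inner_sum_left metric power2_norm_eq_inner sum_negf)
    then have "(\<Sum>e\<in>E. (norm (D e x))\<^sup>2) = 0" using that by simp
    then show ?thesis using that E(1) by (simp add: sum_nonneg_eq_0_iff)
  qed
  have span: "D x y = 0" if "\<And>e. e \<in> E \<Longrightarrow> D e y = 0" "x \<in> S" for x y
  proof -
    have "D x y = (\<Sum>e\<in>E. B x e *\<^sub>R D e y)"
      by (subst E(4)[OF that(2), symmetric]) (simp add: linear_sum[OF linear_left] lin_simps)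
    then show ?thesis using that(1) by simp
  qed
  have "C w \<bullet> w = 0" using metric_self[of w w] by (simp add: Dw[OF wS, symmetric] inner_commute)
  then have "D z w = 0" if "z \<in> S" for z using C_0 span that by blast
  then have "C y = 0" if "y \<in> S" for y using Dw that by metis
  moreover have xy: "x \<in> S" "y \<in> S" using x y by (auto simp: S_def)
  ultimately show ?thesis using C_0 span by (metis inner_zero_left)
qed

text \<open>
  Split \<open>x\<close> and \<open>y\<close> along the kernel and its complement: the part of \<open>D x y\<close> coming from the two
  complementary components vanishes, and the rest lies in the kernel. Since \<open>D\<close>
  vanishes on brackets, flatness then says that the \<open>D x\<close> commute with each other.
\<close>

theorem D_D_left_eq_0 [simp]: "D (D x y) z = 0"
proof -
  obtain p q where x: "p \<in> flat_kernel" "\<And>k. k \<in> flat_kernel \<Longrightarrow> q \<bullet> k = 0" "x = p + q"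
    by (rule flat_kernel_split[of x]) (rule that)
  obtain s t where y: "s \<in> flat_kernel" "\<And>k. k \<in> flat_kernel \<Longrightarrow> t \<bullet> k = 0" "y = s + t"
    by (rule flat_kernel_split[of y]) (rule that)
  have "D q t = 0" by (rule D_eq_0_orthogonal_flat_kernel[OF x(2) y(2)])
  then have "D x y = D q s" using x(1) by (simp add: x(3) y(3) lin_simps flat_kernel_def)
  then show ?thesis using D_flat_kernel[OF y(1)] by (simp add: flat_kernel_def)
qed

lemma D_commute: "D x (D y z) = D y (D x z)"
  using flat[of x y z] by (simp add: lin_simps)

lemma parallel_if_orthogonal_flat_kernel:
  assumes "\<And>k. k \<in> flat_kernel \<Longrightarrow> x \<bullet> k = 0"
  shows "D y x = 0"
proof -
  have "D y x \<in> flat_kernel" by (simp add: flat_kernel_def)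
  then have "D y x \<bullet> D y x = 0" using D_orthogonal_flat_kernel[OF assms] by blast
  then show ?thesis by simp
qed

text \<open>
  For central \<open>c\<close> the product \<open>D c y = D y c\<close> is symmetric; skewness gives \<open>D c c = 0\<close>, commutation then
  gives \<open>D c (D c y) = D y (D c c) = 0\<close>, and a skew operator with square zero is zero.
\<close>

lemma lie_center_subset: "lie_center bracket \<subseteq> flat_kernel"
proof
  fix c assume "c \<in> lie_center bracket"
  then have "D c y - D y c = 0" for y unfolding lie_center_def bracket_def by blast
  then have c: "D c y = D y c" for y by (rule eq_iff_diff_eq_0[THEN iffD2])
  have "D c c \<bullet> y = 0" for y
    by (simp only: metric c[of y] metric_self minus_zero)
  then have cc: "D c c = 0" by (metis inner_eq_zero_iff)
  have "D c (D c y) = 0" for y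
    by (simp only: c[of y] D_commute[of c y c] cc lin_simps)
  then have "D c y \<bullet> D c y = 0" for y by (simp add: metric)
  then show "c \<in> flat_kernel" by (simp add: flat_kernel_def)
qed

lemma commutator_ideal_subset: "commutator_ideal bracket \<subseteq> flat_kernel"
  unfolding commutator_ideal_def bracket_def
  by (rule span_minimal) (auto simp: subspace_flat_kernel, simp add: flat_kernel_def lin_simps)

text \<open>
  Center and commutator ideal both lie in the kernel of \<open>D\<close>. This makes the metaflat condition, which
  speaks of the summand \<open>s\<close>, available on the orthogonal complement of the kernel.
\<close>

lemma orthogonal_flat_kernel_in_flat_complement:
  assumes "\<And>k. k \<in> flat_kernel \<Longrightarrow> x \<bullet> k = 0"
  shows "x \<in> flat_complement bracket (\<bullet>)"
  using assms[OF subsetD[OF lie_center_subset]] assms[OF subsetD[OF commutator_ideal_subset]]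
  by (simp add: flat_complement_def inner_add_right)

end

section \<open>Duality of Lie bialgebras\<close>

lemma linear_imp_bounded_linear_dual_bases:
  fixes f :: "'v::real_normed_vector \<Rightarrow> 'w::real_normed_vector" and b :: "'i \<Rightarrow> 'v"
  assumes D: "dual_bases I b c" and f: "linear f"
  shows "bounded_linear f"
proof -
  have "f x = (\<Sum>i\<in>I. c i x *\<^sub>R f (b i))" for x
  proof -
    have "x = (\<Sum>i\<in>I. c i x *\<^sub>R b i)" using D by (simp add: dual_bases_def)
    then have "f x = f (\<Sum>i\<in>I. c i x *\<^sub>R b i)" by (rule arg_cong)
    then show ?thesis by (simp only: linear_sum[OF f] linear_cmul[OF f])
  qed
  then have "f = (\<lambda>x. \<Sum>i\<in>I. c i x *\<^sub>R f (b i))" by blast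
  moreover have "bounded_linear (\<lambda>x. \<Sum>i\<in>I. c i x *\<^sub>R f (b i))"
    by (intro bounded_linear_sum bounded_linear_scaleR_const blinfun.bounded_linear_right)
  ultimately show ?thesis by simp
qed

lemma evaluation_surj_dual_bases:
  fixes \<Phi> :: "'v::real_normed_vector dual dual"
  assumes D: "dual_bases I b c"
  shows "\<Phi> = evaluation (\<Sum>i\<in>I. \<Phi> (c i) *\<^sub>R b i)"
proof (rule blinfun_eqI)
  fix \<alpha> :: "'v dual"
  have "\<alpha> = (\<Sum>i\<in>I. evaluation (b i) \<alpha> *\<^sub>R c i)"
    using dual_bases_dual[OF D] by (simp add: dual_bases_def)
  then have "\<Phi> \<alpha> = \<Phi> (\<Sum>i\<in>I. evaluation (b i) \<alpha> *\<^sub>R c i)" by (rule arg_cong)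
  then show "\<Phi> \<alpha> = evaluation (\<Sum>i\<in>I. \<Phi> (c i) *\<^sub>R b i) \<alpha>"
    by (simp add: blinfun.sum_right blinfun.scaleR_right mult.commute)
qed

definition pullback :: "('v::real_normed_vector \<Rightarrow> 'v) \<Rightarrow> 'v dual \<Rightarrow> 'v dual" where
  "pullback f \<alpha> = Blinfun (\<lambda>y. \<alpha> (f y))"

lemma pullback_apply:
  fixes f :: "'v::real_normed_vector \<Rightarrow> 'v" and b :: "'i \<Rightarrow> 'v"
  assumes D: "dual_bases I b c" and f: "linear f"
  shows "pullback f \<alpha> x = \<alpha> (f x)"
  unfolding pullback_def
  by (simp add: bounded_linear_Blinfun_apply bounded_linear_compose[OF blinfun.bounded_linear_right]
      linear_imp_bounded_linear_dual_bases[OF D f])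

lemma ad_bivector_apply:
  fixes br :: "'v::real_normed_vector \<Rightarrow> 'v \<Rightarrow> 'v" and b :: "'i \<Rightarrow> 'v"
  assumes D: "dual_bases I b c" and br: "bilinear br" and \<omega>: "\<omega> \<in> bivectors"
  shows "ad_bivector br x \<omega> \<alpha> \<beta> = \<omega> (pullback (br x) \<alpha>) \<beta> + \<omega> \<alpha> (pullback (br x) \<beta>)"
proof -
  have l: "linear (br x)" using br by (simp add: bilinear_def)
  show ?thesis
  proof (rule linear_eq_on_bivectors[OF _ _ _ \<omega>])
    note ad = linear_ad_bivector[OF D br, of x]
    show "linear (\<lambda>\<omega>. ad_bivector br x \<omega> \<alpha> \<beta>)"
      by (rule linearI)
        (simp_all add: linear_add[OF ad] linear_cmul[OF ad] blinfun.add_left blinfun.scaleR_left)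
    show "linear (\<lambda>\<omega>::'v bivector. \<omega> (pullback (br x) \<alpha>) \<beta> + \<omega> \<alpha> (pullback (br x) \<beta>))"
      by (rule linearI) (simp_all add: blinfun.add_left blinfun.scaleR_left algebra_simps)
    show "ad_bivector br x (wedge y z) \<alpha> \<beta> =
        wedge y z (pullback (br x) \<alpha>) \<beta> + wedge y z \<alpha> (pullback (br x) \<beta>)" for y z
      by (simp add: ad_bivector_wedge[OF D br] wedge_apply pullback_apply[OF D l]
          blinfun.add_left)
  qed
qed

lemma dual_bracket_apply_dual_bases:
  fixes \<xi> :: "'v::real_normed_vector \<Rightarrow> 'v bivector" and b :: "'i \<Rightarrow> 'v"
  assumes D: "dual_bases I b c" and \<xi>: "linear \<xi>" "\<And>x. \<xi> x \<in> bivectors"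
  shows "dual_bracket \<xi> \<alpha> \<beta> x = \<xi> x \<alpha> \<beta>"
proof -
  have "linear (\<lambda>x. \<xi> x \<alpha> \<beta>)"
    by (rule linearI)
      (simp_all add: linear_add[OF \<xi>(1)] linear_cmul[OF \<xi>(1)] blinfun.add_left blinfun.scaleR_left)
  then show ?thesis
    unfolding dual_bracket_def bivector_pairing_eq(1)[OF D \<xi>(2)]
    by (simp add: bounded_linear_Blinfun_apply linear_imp_bounded_linear_dual_bases[OF D])
qed

lemma
  fixes br :: "'v::real_normed_vector \<Rightarrow> 'v \<Rightarrow> 'v" and b :: "'i \<Rightarrow> 'v"
  assumes D: "dual_bases I b c" and br: "alternating_bilinear br"
  shows dual_cocycle_in_bivectors: "dual_cocycle br \<alpha> \<in> bivectors"
    and dual_cocycle_evaluation: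
      "dual_cocycle br \<alpha> (evaluation x) (evaluation y) = \<alpha> (br x y)"
proof -
  have *: "dual_cocycle br \<alpha> \<in> bivectors \<and>
      (\<forall>x y. bivector_pairing (dual_cocycle br \<alpha>) (wedge x y) = \<alpha> (br x y))"
    unfolding dual_cocycle_def by (rule theI'[OF dual_cocycle_ex1[OF D br]])
  then show "dual_cocycle br \<alpha> \<in> bivectors" ..
  then show "dual_cocycle br \<alpha> (evaluation x) (evaluation y) = \<alpha> (br x y)"
    using * by (simp flip: bivector_pairing_wedge_right[OF D])
qed

lemma linear_dual_cocycle:
  fixes br :: "'v::real_normed_vector \<Rightarrow> 'v \<Rightarrow> 'v" and b :: "'i \<Rightarrow> 'v"
  assumes D: "dual_bases I b c" and br: "alternating_bilinear br"
  shows "linear (dual_cocycle br)"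
  by (rule linearI; rule bivector_dual_eqI[OF D])
    (simp_all add: dual_cocycle_evaluation[OF D br] blinfun.add_left blinfun.scaleR_left)

text \<open>
  Self-duality of the bialgebra condition. Evaluated on functionals \<open>\<alpha>\<close>, \<open>\<beta>\<close> and vectors \<open>x\<close>, \<open>y\<close>, the
  cocycle identities for \<open>\<xi>\<close> and for the dual cocycle express \<open>\<xi> (br x y) \<alpha> \<beta>\<close> by the same four
  terms: a functional pulled back along \<open>br x\<close> in one reading becomes an element of the bidual pulled
  back along the dual bracket in the other, and reflexivity identifies that element with a vector.
\<close>

lemma one_cocycle_dual_cocycle:
  fixes br :: "'v::real_normed_vector \<Rightarrow> 'v \<Rightarrow> 'v" and b :: "'i \<Rightarrow> 'v"
  assumes D: "dual_bases I b c" and br: "alternating_bilinear br" and \<xi>: "one_cocycle br \<xi>"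
    and br': "bilinear (dual_bracket \<xi>)"
  shows "one_cocycle (dual_bracket \<xi>) (dual_cocycle br)"
  unfolding one_cocycle_def
proof (intro conjI allI)
  note D' = dual_bases_dual[OF D]
  have bil: "bilinear br" using br by (simp add: alternating_bilinear_def)
  have lin_br: "linear (br x)" for x using bil by (simp add: bilinear_def)
  have lin_br': "linear (dual_bracket \<xi> \<alpha>)" for \<alpha> using br' by (simp add: bilinear_def)
  have lin: "linear \<xi>" and biv: "\<And>x. \<xi> x \<in> bivectors"
    and coc: "\<And>x y. \<xi> (br x y) = ad_bivector br x (\<xi> y) - ad_bivector br y (\<xi> x)"
    using \<xi> by (auto simp: one_cocycle_def)
  note dba = dual_bracket_apply_dual_bases[OF D lin biv]
  note dc = dual_cocycle_in_bivectors[OF D br] and dce = dual_cocycle_evaluation[OF D br]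
  show "linear (dual_cocycle br)" by (rule linear_dual_cocycle[OF D br])
  show "dual_cocycle br \<alpha> \<in> bivectors" for \<alpha> by (rule dc)
  fix \<alpha> \<beta> :: "'v dual"
  have right: "dual_cocycle br \<beta> (evaluation x) (pullback (dual_bracket \<xi> \<alpha>) (evaluation y))
      = \<xi> y \<alpha> (pullback (br x) \<beta>)" for \<alpha> \<beta> :: "'v dual" and x y
  proof -
    obtain y' where y': "pullback (dual_bracket \<xi> \<alpha>) (evaluation y) = evaluation y'"
      using evaluation_surj_dual_bases[OF D] by blast
    have "\<gamma> y' = \<xi> y \<alpha> \<gamma>" for \<gamma> :: "'v dual"
      using arg_cong[OF y', of "\<lambda>\<Phi>. \<Phi> \<gamma>"] by (simp add: pullback_apply[OF D' lin_br'] dba)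
    moreover have "\<beta> (br x y') = pullback (br x) \<beta> y'" by (simp add: pullback_apply[OF D lin_br])
    ultimately show ?thesis by (simp add: y' dce)
  qed
  have left: "dual_cocycle br \<beta> (pullback (dual_bracket \<xi> \<alpha>) (evaluation x)) (evaluation y)
      = - \<xi> x \<alpha> (pullback (br y) \<beta>)" for \<alpha> \<beta> x y
    using right[of \<beta> y \<alpha> x] by (subst bivector_skew[OF dc]) simp
  show "dual_cocycle br (dual_bracket \<xi> \<alpha> \<beta>) =
      ad_bivector (dual_bracket \<xi>) \<alpha> (dual_cocycle br \<beta>) -
      ad_bivector (dual_bracket \<xi>) \<beta> (dual_cocycle br \<alpha>)"
  proof (rule bivector_dual_eqI[OF D])
    fix x y
    have "dual_cocycle br (dual_bracket \<xi> \<alpha> \<beta>) (evaluation x) (evaluation y) =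
        \<xi> y (pullback (br x) \<alpha>) \<beta> + \<xi> y \<alpha> (pullback (br x) \<beta>)
        - (\<xi> x (pullback (br y) \<alpha>) \<beta> + \<xi> x \<alpha> (pullback (br y) \<beta>))"
      by (simp add: dce dba coc blinfun.diff_left ad_bivector_apply[OF D bil biv])
    also have "\<dots> = - \<xi> y \<beta> (pullback (br x) \<alpha>) + \<xi> y \<alpha> (pullback (br x) \<beta>)
        - (- \<xi> x \<beta> (pullback (br y) \<alpha>) + \<xi> x \<alpha> (pullback (br y) \<beta>))"
      using bivector_skew[OF biv, of y "pullback (br x) \<alpha>" \<beta>]
        bivector_skew[OF biv, of x "pullback (br y) \<alpha>" \<beta>] by simp
    also have "\<dots> = (ad_bivector (dual_bracket \<xi>) \<alpha> (dual_cocycle br \<beta>) -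
      ad_bivector (dual_bracket \<xi>) \<beta> (dual_cocycle br \<alpha>)) (evaluation x) (evaluation y)"
      by (simp add: blinfun.diff_left ad_bivector_apply[OF D' br' dc] left right)
    finally show "dual_cocycle br (dual_bracket \<xi> \<alpha> \<beta>) (evaluation x) (evaluation y) =
        (ad_bivector (dual_bracket \<xi>) \<alpha> (dual_cocycle br \<beta>) -
      ad_bivector (dual_bracket \<xi>) \<beta> (dual_cocycle br \<alpha>)) (evaluation x) (evaluation y)" .
  qed
qed

lemma span_dual_bases:
  assumes "dual_bases I b c"
  shows "span (b ` I) = UNIV"
proof -
  have "(\<Sum>i\<in>I. c i x *\<^sub>R b i) \<in> span (b ` I)" for x
    by (intro span_sum span_scale span_base imageI)
  moreover have "(\<Sum>i\<in>I. c i x *\<^sub>R b i) = x" for x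
    using assms unfolding dual_bases_def by metis
  ultimately show ?thesis by auto
qed

text \<open>
  Only the third Lie algebra, on the bidual, remains after the cocycle identity. It is the original
  one transported along the evaluation isomorphism.
\<close>

theorem lie_bialgebra_dual:
  fixes br :: "'v::real_normed_vector \<Rightarrow> 'v \<Rightarrow> 'v" and b :: "'i \<Rightarrow> 'v"
  assumes D: "dual_bases I b c" and bialgebra: "lie_bialgebra br \<xi>"
  shows "lie_bialgebra (dual_bracket \<xi>) (dual_cocycle br)"
proof -
  note D' = dual_bases_dual[OF D] and D'' = dual_bases_dual[OF dual_bases_dual[OF D]]
  have lie: "bilinear br" "\<And>x. br x x = 0"
    "\<And>x y z. br x (br y z) + br y (br z x) + br z (br x y) = 0"
    and \<xi>: "one_cocycle br \<xi>" and lie': "lie_algebra (dual_bracket \<xi>)"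
    using bialgebra by (auto simp: lie_bialgebra_def lie_algebra_def)
  have br: "alternating_bilinear br" using lie by (simp add: alternating_bilinear_def)
  have "bilinear (dual_bracket \<xi>)" using lie' by (simp add: lie_algebra_def)
  from one_cocycle_dual_cocycle[OF D br \<xi> this]
  have coc: "one_cocycle (dual_bracket \<xi>) (dual_cocycle br)" .
  note dba = dual_bracket_apply_dual_bases[OF D' linear_dual_cocycle[OF D br]
      dual_cocycle_in_bivectors[OF D br]]
  have eval: "dual_bracket (dual_cocycle br) (evaluation x) (evaluation y) = evaluation (br x y)"
    for x y
    by (rule blinfun_eqI) (simp add: dba dual_cocycle_evaluation[OF D br])
  have surj: "\<exists>x. \<Phi> = evaluation x" for \<Phi> :: "'v dual dual"
    using evaluation_surj_dual_bases[OF D] by blast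
  have ev_add: "evaluation x + evaluation y = evaluation (x + y)" for x y :: 'v
    by (rule blinfun_eqI) (simp add: blinfun.add_left blinfun.add_right)
  have "lie_algebra (dual_bracket (dual_cocycle br))"
    unfolding lie_algebra_def
  proof (intro conjI allI)
    show "\<exists>B. finite B \<and> span B = (UNIV :: 'v dual dual set)"
      using span_dual_bases[OF D''] D by (auto simp: dual_bases_def)
    show "bilinear (dual_bracket (dual_cocycle br))"
      unfolding bilinear_def
      by (auto intro!: linearI blinfun_eqI simp: dba blinfun.add_left blinfun.add_right
          blinfun.scaleR_left blinfun.scaleR_right)
    fix X Y Z :: "'v dual dual"
    obtain x y z where "X = evaluation x" "Y = evaluation y" "Z = evaluation z"
      using surj by metis
    moreover have "evaluation 0 = (0 :: 'v dual dual)" by (rule blinfun_eqI) simp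
    ultimately show "dual_bracket (dual_cocycle br) X X = 0"
      "dual_bracket (dual_cocycle br) X (dual_bracket (dual_cocycle br) Y Z) +
       dual_bracket (dual_cocycle br) Y (dual_bracket (dual_cocycle br) Z X) +
       dual_bracket (dual_cocycle br) Z (dual_bracket (dual_cocycle br) X Y) = 0"
      by (simp_all add: eval lie ev_add)
  qed
  with coc lie' show ?thesis by (simp add: lie_bialgebra_def)
qed

section \<open>Bivectors as skew operators\<close>

abbreviation sharp :: "'v::euclidean_space \<Rightarrow> 'v dual" where
  "sharp \<equiv> blinfun_inner_right"

lemma linear_sharp: "linear sharp"
  by (rule bounded_linear.linear[OF bounded_linear_blinfun_inner_right])

text \<open>
  A bivector as an endomorphism, by identifying the space with its dual through the inner product:
  \<open>\<langle>bivector_operator \<omega> a, b\<rangle> = \<omega> (sharp a, sharp b)\<close>. Bivectors become skew operators.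
\<close>

definition bivector_operator :: "'v::euclidean_space bivector \<Rightarrow> 'v \<Rightarrow> 'v" where
  "bivector_operator \<omega> a = (\<Sum>i\<in>Basis. \<omega> (sharp a) (sharp i) *\<^sub>R i)"

lemma linear_bivector_operator: "linear (bivector_operator \<omega>)"
  unfolding bivector_operator_def
  by (rule linearI)
    (simp_all add: linear_add[OF linear_sharp] linear_cmul[OF linear_sharp] blinfun.add_left
      blinfun.add_right blinfun.scaleR_left blinfun.scaleR_right scaleR_add_left sum.distrib
      scaleR_sum_right)

lemma bivector_operator_inner:
  "bivector_operator \<omega> a \<bullet> b = \<omega> (sharp a) (sharp b)"
proof -
  have "\<omega> (sharp a) (sharp b)
      = \<omega> (sharp a) (sharp (\<Sum>i\<in>Basis. (b \<bullet> i) *\<^sub>R i))"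
    by (simp add: euclidean_representation)
  also have "\<dots> = (\<Sum>i\<in>Basis. (b \<bullet> i) * \<omega> (sharp a) (sharp i))"
    by (simp add: linear_sum[OF linear_sharp] linear_cmul[OF linear_sharp] blinfun.sum_right
        blinfun.scaleR_right)
  also have "\<dots> = bivector_operator \<omega> a \<bullet> b"
    by (simp add: bivector_operator_def inner_sum_left inner_commute[of b] mult.commute)
  finally show ?thesis by simp
qed

lemma
  shows bivector_operator_add: "bivector_operator (\<omega> + \<eta>) a = bivector_operator \<omega> a + bivector_operator \<eta> a"
    and bivector_operator_scaleR: "bivector_operator (k *\<^sub>R \<omega>) a = k *\<^sub>R bivector_operator \<omega> a"
    and bivector_operator_zero: "bivector_operator 0 a = 0"
  by (simp_all add: bivector_operator_def blinfun.add_left blinfun.scaleR_left scaleR_add_left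
      sum.distrib scaleR_sum_right)

lemma bivector_operator_wedge:
  "bivector_operator (wedge x y) a = (a \<bullet> x) *\<^sub>R y - (a \<bullet> y) *\<^sub>R x"
proof (rule vector_eq_ldot[THEN iffD1], rule allI)
  fix b
  show "b \<bullet> bivector_operator (wedge x y) a = b \<bullet> ((a \<bullet> x) *\<^sub>R y - (a \<bullet> y) *\<^sub>R x)"
    by (simp add: inner_commute[of b "bivector_operator _ _"] bivector_operator_inner wedge_apply
        inner_diff_right mult.commute)
qed

lemma skew_bivector_operator:
  assumes "\<omega> \<in> bivectors"
  shows "bivector_operator \<omega> a \<bullet> b = - (a \<bullet> bivector_operator \<omega> b)"
  unfolding inner_commute[of a "bivector_operator \<omega> b"] bivector_operator_inner
  by (rule bivector_skew[OF assms])

lemma ad_bivector_sharp: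
  fixes br :: "'v::euclidean_space \<Rightarrow> 'v \<Rightarrow> 'v"
  assumes br: "bilinear br" and \<omega>: "\<omega> \<in> bivectors"
  shows "ad_bivector br x \<omega> (sharp a) (sharp b) =
    br x (bivector_operator \<omega> a) \<bullet> b - br x (bivector_operator \<omega> b) \<bullet> a"
proof (rule linear_eq_on_bivectors[OF _ _ _ \<omega>])
  note D = dual_bases_euclidean[where 'v = 'v]
  note ad = linear_ad_bivector[OF D br, of x]
  note lin = bilinear_radd[OF br] bilinear_rmul[OF br] bilinear_rsub[OF br]
  show "linear (\<lambda>\<omega>. ad_bivector br x \<omega> (sharp a) (sharp b))"
    by (rule linearI)
      (simp_all add: linear_add[OF ad] linear_cmul[OF ad] blinfun.add_left blinfun.scaleR_left)
  show "linear (\<lambda>\<omega>. br x (bivector_operator \<omega> a) \<bullet> b - br x (bivector_operator \<omega> b) \<bullet> a)"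
    by (rule linearI)
      (simp_all add: bivector_operator_add bivector_operator_scaleR lin inner_add_left algebra_simps)
  show "ad_bivector br x (wedge y z) (sharp a) (sharp b) =
      br x (bivector_operator (wedge y z) a) \<bullet> b - br x (bivector_operator (wedge y z) b) \<bullet> a" for y z
    by (simp add: ad_bivector_wedge[OF D br] blinfun.add_left wedge_apply bivector_operator_wedge
        lin inner_diff_left inner_commute algebra_simps)
qed

text \<open>
  The pairing of a vector with the bracket of two contracted bivectors, skew-symmetrised in the last
  two arguments. The Schouten bracket is its cyclic sum.
\<close>

definition bracket_contraction ::
  "('v::euclidean_space \<Rightarrow> 'v \<Rightarrow> 'v) \<Rightarrow> 'v bivector \<Rightarrow> 'v bivector \<Rightarrow> 'v \<Rightarrow> 'v \<Rightarrow> 'v \<Rightarrow> real" where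
  "bracket_contraction br r s a b c =
     a \<bullet> br (bivector_operator r b) (bivector_operator s c)
   - a \<bullet> br (bivector_operator r c) (bivector_operator s b)"

lemma schouten_sharp:
  fixes br :: "'v::euclidean_space \<Rightarrow> 'v \<Rightarrow> 'v"
  assumes br: "bilinear br" and r: "r \<in> bivectors" and s: "s \<in> bivectors"
  shows "schouten br r s (sharp a) (sharp b) (sharp c) =
    bracket_contraction br r s a b c + bracket_contraction br r s b c a
    + bracket_contraction br r s c a b" (is "?S r s = ?T r s")
proof -
  note D = dual_bases_euclidean[where 'v = 'v]
  note lin = bilinear_radd[OF br] bilinear_rmul[OF br] bilinear_rsub[OF br]
    bilinear_ladd[OF br] bilinear_lmul[OF br] bilinear_lsub[OF br]
  have wedge: "?S (wedge x y) s = ?T (wedge x y) s" for x y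
  proof -
    define h where "h = (\<lambda>Y1 Y2. wedge3 (br x Y1) y Y2 - wedge3 (br x Y2) y Y1
        - wedge3 (br y Y1) x Y2 + wedge3 (br y Y2) x Y1)"
    have lift: "schouten br (wedge x y) t = wedge_lift h t" if "t \<in> bivectors" for t
      unfolding schouten_def h_def
      by (rule wedge_lift_wedge[OF D alternating_lift_param[OF D alternating_schouten[OF br] that]])
    have alt: "alternating_bilinear h"
      unfolding h_def by (rule alternating_schouten(1)[OF br])
    note wl = linear_wedge_lift[OF D alt]
    have "wedge_lift h s (sharp a) (sharp b) (sharp c)
        = ?T (wedge x y) s"
    proof (rule linear_eq_on_bivectors[OF _ _ _ s])
      show "linear (\<lambda>t. wedge_lift h t (sharp a) (sharp b) (sharp c))"
        by (rule linearI)
          (simp_all add: linear_add[OF wl] linear_cmul[OF wl] blinfun.add_left blinfun.scaleR_left)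
      show "linear (\<lambda>t. ?T (wedge x y) t)"
        by (rule linearI)
          (simp_all add: bracket_contraction_def bivector_operator_add bivector_operator_scaleR lin
            inner_add_right algebra_simps)
      show "wedge_lift h (wedge u v) (sharp a) (sharp b) (sharp c)
          = ?T (wedge x y) (wedge u v)" for u v
        by (subst wedge_lift_wedge[OF D alt]) (simp add: h_def wedge3_apply bracket_contraction_def
            bivector_operator_wedge lin blinfun.add_left blinfun.diff_left inner_diff_right
            inner_commute algebra_simps)
    qed
    then show ?thesis by (simp add: lift[OF s])
  qed
  note ls = linear_schouten_left[OF D br s]
  show ?thesis
  proof (rule linear_eq_on_bivectors[OF _ _ _ r])
    show "?S (wedge x y) s = ?T (wedge x y) s" for x y by (rule wedge)
    show "linear (\<lambda>r. ?S r s)"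
      by (rule linearI)
        (simp_all add: linear_add[OF ls] linear_cmul[OF ls] blinfun.add_left blinfun.scaleR_left)
    show "linear (\<lambda>r. ?T r s)"
      by (rule linearI)
        (simp_all add: bracket_contraction_def bivector_operator_add bivector_operator_scaleR lin
          inner_add_right algebra_simps)
  qed
qed

lemma ad_bivector_in_bivectors:
  fixes br :: "'v::euclidean_space \<Rightarrow> 'v \<Rightarrow> 'v"
  assumes br: "bilinear br" and \<omega>: "\<omega> \<in> bivectors"
  shows "ad_bivector br x \<omega> \<in> bivectors"
proof -
  note D = dual_bases_euclidean[where 'v = 'v]
  note ad = linear_ad_bivector[OF D br, of x]
  have "\<omega> \<in> span {wedge y z | y z. True}" using \<omega> by (simp add: bivectors_def)
  then show ?thesis
  proof (induction rule: span_induct_alt)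
    case base
    then show ?case by (simp add: linear_0[OF ad] bivectors_def span_zero)
  next
    case (step k w \<eta>)
    then obtain y z where "w = wedge y z" by blast
    then have "ad_bivector br x w \<in> bivectors"
      using wedge_in_bivectors
      by (auto simp: ad_bivector_wedge[OF D br] bivectors_def intro: span_add)
    with step.IH show ?case
      by (simp add: linear_add[OF ad] linear_cmul[OF ad] bivectors_def span_add span_scale)
  qed
qed

section \<open>Flat Lie algebras and flat connections\<close>

lemma flat_lie_algebra_imp_flat_connection:
  fixes br :: "'v::euclidean_space \<Rightarrow> 'v \<Rightarrow> 'v"
  assumes "flat_lie_algebra br (\<bullet>)"
  obtains D where "flat_connection D" "br = (\<lambda>x y. D x y - D y x)"
proof -
  define D where "D = levi_civita br (\<bullet>)"
  have lie: "lie_algebra br" and ip: "scalar_product ((\<bullet>) :: 'v \<Rightarrow> 'v \<Rightarrow> real)"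
    and flat: "\<And>x y z. D (br x y) z - (D x (D y z) - D y (D x z)) = 0"
    using assms by (simp_all add: flat_lie_algebra_def D_def Let_def)
  have br: "bilinear br" and "\<And>x. br x x = 0" using lie by (auto simp: lie_algebra_def)
  then have alt: "alternating_bilinear br" by (simp add: alternating_bilinear_def)
  have koszul: "2 * (D x y \<bullet> z) = br x y \<bullet> z + br z x \<bullet> y + br z y \<bullet> x" for x y z
    unfolding D_def by (rule levi_civita_koszul[OF br ip inner_represents])
  note swap = alternating_swap[OF alt]
  have eqI: "v = w" if "\<And>z. 2 * (v \<bullet> z) = 2 * (w \<bullet> z)" for v w :: 'v
    using that vector_eq_rdot[of v w] by simp
  note lin = bilinear_ladd[OF br] bilinear_lmul[OF br] bilinear_radd[OF br] bilinear_rmul[OF br]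
  have torsion: "br x y = D x y - D y x" for x y
  proof (rule eqI)
    fix z
    show "2 * (br x y \<bullet> z) = 2 * ((D x y - D y x) \<bullet> z)"
      using koszul[of x y z] koszul[of y x z] swap[of y x] by (simp add: inner_diff_left)
  qed
  have "flat_connection D"
  proof
    show "bilinear D"
      unfolding bilinear_def
    proof (intro conjI allI linearI)
      fix x y z and k :: real
      show "D x (y + z) = D x y + D x z"
        by (rule eqI) (simp add: inner_add_left distrib_left koszul lin inner_add_right)
      show "D (x + z) y = D x y + D z y"
        by (rule eqI) (simp add: inner_add_left distrib_left koszul lin inner_add_right)
      show "D x (k *\<^sub>R y) = k *\<^sub>R D x y"
        using koszul[of x y]
        by (intro eqI) (simp add: koszul lin mult.left_commute[of 2] flip: distrib_left)
      show "D (k *\<^sub>R x) y = k *\<^sub>R D x y"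
        by (intro eqI) (simp add: koszul lin mult.left_commute[of 2] flip: distrib_left)
    qed
    fix x y z
    show "D x y \<bullet> z = - (y \<bullet> D x z)"
      using koszul[of x y z] koszul[of x z y] swap[of z y] swap[of z x] swap[of y x]
      by (simp add: inner_commute[of y "D x z"])
    show "D (D x y - D y x) z = D x (D y z) - D y (D x z)"
      using flat[of x y z] by (simp add: torsion)
  qed
  moreover have "br = (\<lambda>x y. D x y - D y x)" using torsion by blast
  ultimately show thesis by (rule that)
qed

lemma levi_civita_eqI:
  fixes br :: "'v::real_vector \<Rightarrow> 'v \<Rightarrow> 'v"
  assumes ip: "scalar_product ip"
    and metric: "\<And>x y z. ip (N x y) z = - ip y (N x z)"
    and torsion: "\<And>x y. br x y = N x y - N y x"
  shows "levi_civita br ip x y = N x y"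
proof -
  have b: "bilinear ip" and sym: "\<And>x y. ip x y = ip y x" and pos: "\<And>x. x \<noteq> 0 \<Longrightarrow> ip x x > 0"
    using ip by (auto simp: scalar_product_def)
  have koszul: "2 * ip (N x y) z = ip (br x y) z + ip (br z x) y + ip (br z y) x" for z
    using metric[of z x y] metric[of x z y] metric[of y z x] metric[of x y z] metric[of y x z]
      sym[of x "N z y"] sym[of y "N x z"] sym[of x "N y z"] sym[of z "N x y"] sym[of z "N y x"]
    by (simp add: torsion bilinear_lsub[OF b])
  show ?thesis
    unfolding levi_civita_def
  proof (rule the_equality)
    show "\<forall>z. 2 * ip (N x y) z = ip (br x y) z + ip (br z x) y + ip (br z y) x"
      using koszul by blast
    fix v assume "\<forall>z. 2 * ip v z = ip (br x y) z + ip (br z x) y + ip (br z y) x"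
    then have "2 * ip v z = 2 * ip (N x y) z" for z by (simp only: koszul)
    then have "ip (v - N x y) (v - N x y) = 0" by (simp add: bilinear_lsub[OF b])
    then show "v = N x y" using pos[of "v - N x y"] by fastforce
  qed
qed

text \<open>
  The converse of the identities \<open>D (D x y) z = 0\<close> and \<open>D x (D y z) = D y (D x z)\<close> for flat Lie algebras:
  a product by commuting skew operators in which products act by zero is the Levi-Civita product of
  its commutator. The curvature vanishes since both of its terms do, and the Jacobi identity is the
  Bianchi identity of a torsion-free flat connection.
\<close>

lemma flat_lie_algebra_of_commuting_skew:
  fixes N :: "'v::real_vector \<Rightarrow> 'v \<Rightarrow> 'v"
  assumes fin: "finite B" "span B = (UNIV :: 'v set)"
    and ip: "scalar_product ip" and N: "bilinear N"
    and metric: "\<And>x y z. ip (N x y) z = - ip y (N x z)"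
    and commute: "\<And>x y z. N x (N y z) = N y (N x z)"
    and nilpotent: "\<And>x y z. N (N x y) z = 0"
  shows "flat_lie_algebra (\<lambda>x y. N x y - N y x) ip"
proof -
  let ?br = "\<lambda>x y. N x y - N y x"
  note lin = bilinear_ladd[OF N] bilinear_lmul[OF N] bilinear_lsub[OF N]
    bilinear_radd[OF N] bilinear_rmul[OF N] bilinear_rsub[OF N]
  have bil: "bilinear ?br"
    unfolding bilinear_def by (auto intro!: linearI simp: lin algebra_simps)
  have jacobi: "?br x (?br y z) + ?br y (?br z x) + ?br z (?br x y) = 0" for x y z
    using commute[of x y z] commute[of y z x] commute[of z x y]
    by (simp add: lin nilpotent)
  have "lie_algebra ?br"
    unfolding lie_algebra_def
  proof (intro conjI allI)
    show "\<exists>B. finite B \<and> span B = (UNIV :: 'v set)" using fin by blast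
    show "bilinear ?br" by (rule bil)
    show "?br x x = 0" for x by simp
    show "?br x (?br y z) + ?br y (?br z x) + ?br z (?br x y) = 0" for x y z by (rule jacobi)
  qed
  moreover have "levi_civita ?br ip x y = N x y" for x y
    by (rule levi_civita_eqI[where N = N]) (simp_all add: ip metric)
  moreover have "N (?br x y) z - (N x (N y z) - N y (N x z)) = 0" for x y z
    using commute[of x y z] by (simp add: lin nilpotent)
  ultimately show ?thesis using ip by (simp add: flat_lie_algebra_def Let_def)
qed

section \<open>Invariance of the bivector\<close>

context flat_connection
begin

text \<open>
  On the complement of the kernel \<open>ad x\<close> equals the skew operator \<open>D x\<close>, so its action on bivectors
  is the commutator with \<open>D x\<close>.
\<close>

lemma bivector_operator_ad:
  assumes x: "\<And>k. k \<in> flat_kernel \<Longrightarrow> x \<bullet> k = 0" and \<omega>: "\<omega> \<in> bivectors"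
  shows "bivector_operator (ad_bivector bracket x \<omega>) a
    = D x (bivector_operator \<omega> a) - bivector_operator \<omega> (D x a)"
proof -
  have br: "bracket x y = D x y" for y
    by (simp add: bracket_def parallel_if_orthogonal_flat_kernel[OF x])
  have "bivector_operator (ad_bivector bracket x \<omega>) a \<bullet> b
      = (D x (bivector_operator \<omega> a) - bivector_operator \<omega> (D x a)) \<bullet> b" for b
    by (simp add: bivector_operator_inner[of "ad_bivector bracket x \<omega>"] br
        ad_bivector_sharp[OF bilinear_bracket \<omega>] inner_diff_left
        skew_bivector_operator[OF \<omega>, of "D x a"] metric[of x "bivector_operator \<omega> b"]
        inner_commute[of "D x a"])
  then show ?thesis by (metis vector_eq_rdot)
qed

text \<open>
  The triple commutator of \<open>D q\<close> with the operator of \<open>\<omega>\<close> vanishes for \<open>q\<close> orthogonal to the kernel;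
  two applications of \<open>skew_square_commutator_eq_0\<close> strip off the two outer commutators. Adding an
  element of the kernel to \<open>q\<close> does not change \<open>D q\<close>.
\<close>

lemma bivector_operator_commutes:
  assumes \<omega>: "\<omega> \<in> bivectors"
    and ad3: "\<And>x. (\<And>k. k \<in> flat_kernel \<Longrightarrow> x \<bullet> k = 0) \<Longrightarrow>
      ad_bivector bracket x (ad_bivector bracket x (ad_bivector bracket x \<omega>)) = 0"
  shows "D x (bivector_operator \<omega> a) = bivector_operator \<omega> (D x a)"
proof -
  obtain p q where pq: "p \<in> flat_kernel" "\<And>k. k \<in> flat_kernel \<Longrightarrow> q \<bullet> k = 0" "x = p + q"
    by (rule flat_kernel_split[of x]) (rule that)
  define \<omega>1 where "\<omega>1 = ad_bivector bracket q \<omega>"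
  define \<omega>2 where "\<omega>2 = ad_bivector bracket q \<omega>1"
  have biv: "\<omega>1 \<in> bivectors" "\<omega>2 \<in> bivectors"
    unfolding \<omega>1_def \<omega>2_def by (intro ad_bivector_in_bivectors bilinear_bracket \<omega>)+
  have skew: "skew_operator (bivector_operator \<eta>)" if "\<eta> \<in> bivectors" for \<eta>
    unfolding skew_operator_def
    using linear_bivector_operator skew_bivector_operator[OF that] by blast
  note ad = bivector_operator_ad[OF pq(2)]
  have op1: "bivector_operator \<omega>1 a = D q (bivector_operator \<omega> a) - bivector_operator \<omega> (D q a)" for a
    unfolding \<omega>1_def by (rule ad[OF _ \<omega>])
  have op2: "bivector_operator \<omega>2 a = D q (bivector_operator \<omega>1 a) - bivector_operator \<omega>1 (D q a)" for a
    unfolding \<omega>2_def by (rule ad[OF _ biv(1)])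
  have "ad_bivector bracket q \<omega>2 = 0"
    unfolding \<omega>2_def \<omega>1_def by (rule ad3[OF pq(2)])
  then have "D q (bivector_operator \<omega>2 a) = bivector_operator \<omega>2 (D q a)" for a
    using ad[OF _ biv(2), of a] by (simp add: bivector_operator_zero)
  then have "bivector_operator \<omega>2 a = 0" for a
    using skew_square_commutator_eq_0[OF skew_operator_D skew[OF biv(1)], of q a]
    by (simp add: op2)
  then have "D q (bivector_operator \<omega>1 a) = bivector_operator \<omega>1 (D q a)" for a
    using op2[of a] by simp
  then have "bivector_operator \<omega>1 a = 0" for a
    using skew_square_commutator_eq_0[OF skew_operator_D skew[OF \<omega>], of q a]
    by (simp add: op1)
  then have "D q (bivector_operator \<omega> a) = bivector_operator \<omega> (D q a)"
    using op1[of a] by simp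
  then show ?thesis
    using pq(1) by (simp add: pq(3) lin_simps flat_kernel_def)
qed

end

section \<open>The dual of a flat Lie algebra with an invariant bivector\<close>

lemma sharp_surj: obtains a where "\<alpha> = sharp a"
  using surjD[OF bij_is_surj[OF bij_blinfun_inner_right]] by blast

lemma linear_inv_sharp: "linear (inv (sharp :: 'v::euclidean_space \<Rightarrow> _))"
proof -
  have inv: "inv sharp (sharp a) = a" for a :: 'v
    by (rule inv_f_f[OF bij_is_inj[OF bij_blinfun_inner_right]])
  show ?thesis
  proof (rule linearI)
    fix \<alpha> \<beta> :: "'v dual" and k :: real
    obtain a b where ab: "\<alpha> = sharp a" "\<beta> = sharp b" by (metis sharp_surj)
    show "inv sharp (\<alpha> + \<beta>) = inv sharp \<alpha> + inv sharp \<beta>"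
      by (simp add: ab inv flip: linear_add[OF linear_sharp])
    show "inv sharp (k *\<^sub>R \<alpha>) = k *\<^sub>R inv sharp \<alpha>"
      by (simp add: ab inv flip: linear_cmul[OF linear_sharp])
  qed
qed

lemma scalar_product_dual_inner: "scalar_product (dual_inner :: 'v::euclidean_space dual \<Rightarrow> _)"
proof -
  note l = linear_inv_sharp[where 'v = 'v]
  have "bilinear (dual_inner :: 'v dual \<Rightarrow> _)"
    unfolding bilinear_def dual_inner_def
    by (auto intro!: linearI simp: linear_add[OF l] linear_cmul[OF l] inner_add_left inner_add_right)
  moreover have "dual_inner \<alpha> \<alpha> > 0" if "\<alpha> \<noteq> 0" for \<alpha> :: "'v dual"
  proof -
    obtain a where "\<alpha> = sharp a" by (rule sharp_surj)
    moreover from this that have "a \<noteq> 0" using linear_0[OF linear_sharp] by blast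
    ultimately show ?thesis by (simp add: dual_inner_sharp)
  qed
  ultimately show ?thesis by (simp add: scalar_product_def dual_inner_def inner_commute)
qed

text \<open>
  What the metaflat condition says about the bivector: its operator commutes with all \<open>D x\<close>.
\<close>

locale parallel_bivector = flat_connection D for D :: "'v::euclidean_space \<Rightarrow> 'v \<Rightarrow> 'v" +
  fixes r :: "'v bivector"
  assumes r: "r \<in> bivectors"
    and parallel: "D x (bivector_operator r a) = bivector_operator r (D x a)"
begin

abbreviation R :: "'v \<Rightarrow> 'v" where
  "R \<equiv> bivector_operator r"

abbreviation dual_br :: "'v dual \<Rightarrow> 'v dual \<Rightarrow> 'v dual" where
  "dual_br \<equiv> dual_bracket (coboundary bracket r)"

lemma skew_R: "R a \<bullet> b = - (a \<bullet> R b)"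
  by (rule skew_bivector_operator[OF r])

text \<open>
  The operators \<open>R\<close> and \<open>D (R b)\<close> are skew and commute, so their product is symmetric. Hence
  \<open>F a b c = \<langle>a, D (R b) (R c)\<rangle>\<close> is symmetric under exchange of \<open>a\<close> and \<open>c\<close>, and the terms of the cyclic
  sum that expresses the Schouten bracket cancel in pairs.
\<close>

theorem schouten_eq_0: "schouten bracket r r = 0"
proof (rule trivector_eqI)
  fix \<alpha> \<beta> \<gamma> :: "'v dual"
  obtain a b c where abc: "\<alpha> = sharp a" "\<beta> = sharp b" "\<gamma> = sharp c" by (metis sharp_surj)
  define F where "F a b c = a \<bullet> D (R b) (R c)" for a b c
  have F: "F a b c = F c b a" for a b c
  proof -
    have "F a b c = - (D (R b) a \<bullet> R c)" by (simp add: F_def metric)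
    also have "\<dots> = R (D (R b) a) \<bullet> c" by (simp add: skew_R)
    finally show ?thesis by (simp add: F_def inner_commute flip: parallel)
  qed
  have "bracket_contraction bracket r r a b c = 2 * (F a b c - F a c b)" for a b c
    by (simp add: bracket_contraction_def bracket_def F_def inner_diff_right)
  then show "schouten bracket r r \<alpha> \<beta> \<gamma> = (0 :: 'v trivector) \<alpha> \<beta> \<gamma>"
    using F[of a b c] F[of b c a] F[of c a b]
    by (simp add: abc schouten_sharp[OF bilinear_bracket r r])
qed

text \<open>
  Writing the bracket by \<open>D\<close> gives two kinds of terms. Those with \<open>D x\<close> cancel because \<open>R\<close> commutes
  with \<open>D x\<close>; the others give the right-hand side by skewness.
\<close>

lemma coboundary_sharp:
  "coboundary bracket r x (sharp a) (sharp b) = (D (R a) b - D (R b) a) \<bullet> x"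
proof -
  have "D x (R a) \<bullet> b = D x (R b) \<bullet> a"
    using skew_R[of "D x a" b] metric[of x a "R b"] by (simp add: parallel inner_commute)
  then show ?thesis
    using metric[of "R a" x b] metric[of "R b" x a]
    by (simp add: coboundary_def ad_bivector_sharp[OF bilinear_bracket r] bracket_def
        inner_diff_left inner_diff_right inner_commute)
qed

lemma coboundary_in_bivectors: "coboundary bracket r x \<in> bivectors"
  unfolding coboundary_def by (rule ad_bivector_in_bivectors[OF bilinear_bracket r])

lemma linear_coboundary: "linear (coboundary bracket r)"
proof (rule linearI; rule bivector_eqI)
  fix x y k and \<alpha> \<beta> :: "'v dual"
  obtain a b where ab: "\<alpha> = sharp a" "\<beta> = sharp b" by (metis sharp_surj)
  show "coboundary bracket r (x + y) \<alpha> \<beta> = (coboundary bracket r x + coboundary bracket r y) \<alpha> \<beta>"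
    "coboundary bracket r (k *\<^sub>R x) \<alpha> \<beta> = (k *\<^sub>R coboundary bracket r x) \<alpha> \<beta>"
    by (simp_all add: ab coboundary_sharp blinfun.add_left blinfun.scaleR_left inner_add_right)
qed

lemma dual_bracket_sharp: "dual_br (sharp a) (sharp b) = sharp (D (R a) b - D (R b) a)"
  by (rule blinfun_eqI)
    (simp add: dual_bracket_apply[OF linear_coboundary coboundary_in_bivectors] coboundary_sharp)

text \<open>
  In terms of vectors the dual bracket is the commutator of the product \<open>D (R a) b\<close>. Its operators are
  skew and commute, and \<open>D (R (D (R a) b)) = D (D (R a) (R b)) = 0\<close>.
\<close>

theorem flat_dual: "flat_lie_algebra dual_br dual_inner"
proof -
  define N where "N \<alpha> \<beta> = sharp (D (R (inv sharp \<alpha>)) (inv sharp \<beta>))" for \<alpha> \<beta> :: "'v dual"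
  have inv: "inv sharp (sharp a) = a" for a :: 'v
    by (rule inv_f_f[OF bij_is_inj[OF bij_blinfun_inner_right]])
  have N: "N (sharp a) (sharp b) = sharp (D (R a) b)" for a b by (simp add: N_def inv)
  have br: "dual_br = (\<lambda>\<alpha> \<beta>. N \<alpha> \<beta> - N \<beta> \<alpha>)"
  proof (intro ext)
    fix \<alpha> \<beta> :: "'v dual"
    obtain a b where "\<alpha> = sharp a" "\<beta> = sharp b" by (metis sharp_surj)
    then show "dual_br \<alpha> \<beta> = N \<alpha> \<beta> - N \<beta> \<alpha>"
      by (simp add: dual_bracket_sharp N linear_diff[OF linear_sharp])
  qed
  note D = dual_bases_dual[OF dual_bases_euclidean[where 'v = 'v]]
  note ls = linear_add[OF linear_sharp] linear_cmul[OF linear_sharp]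
    linear_add[OF linear_inv_sharp] linear_cmul[OF linear_inv_sharp]
    linear_add[OF linear_bivector_operator] linear_cmul[OF linear_bivector_operator]
  show ?thesis
    unfolding br
  proof (rule flat_lie_algebra_of_commuting_skew)
    show "finite (sharp ` (Basis :: 'v set))" by simp
    show "span (sharp ` (Basis :: 'v set)) = UNIV" by (rule span_dual_bases[OF D])
    show "scalar_product (dual_inner :: 'v dual \<Rightarrow> _)" by (rule scalar_product_dual_inner)
    show "bilinear N"
      unfolding bilinear_def N_def by (auto intro!: linearI simp: ls lin_simps)
    fix \<alpha> \<beta> \<gamma> :: "'v dual"
    obtain a b c where abc: "\<alpha> = sharp a" "\<beta> = sharp b" "\<gamma> = sharp c" by (metis sharp_surj)
    show "dual_inner (N \<alpha> \<beta>) \<gamma> = - dual_inner \<beta> (N \<alpha> \<gamma>)"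
      by (simp add: abc N dual_inner_sharp metric)
    show "N \<alpha> (N \<beta> \<gamma>) = N \<beta> (N \<alpha> \<gamma>)" by (simp add: abc N D_commute[of "R a"])
    show "N (N \<alpha> \<beta>) \<gamma> = 0" by (simp add: abc N linear_0[OF linear_sharp] flip: parallel)
  qed
qed

text \<open>
  Let \<open>c\<close> be orthogonal to the commutator ideal and the center of the dual algebra. The vectors
  \<open>D (R a) (D (R a) c)\<close> lie in the former, so \<open>D (R a) c = 0\<close> for all \<open>a\<close>. Therefore
  \<open>D x (D x c)\<close> lies in the latter, and \<open>D x c = 0\<close>.
\<close>

lemma flat_complement_dual_parallel:
  assumes c: "sharp c \<in> flat_complement dual_br dual_inner"
  shows "D x c = 0"
proof -
  have zero_if: "D y c = 0" if "c \<bullet> D y (D y c) = 0" for y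
    using that metric[of y c "D y c"] by simp
  have orth: "dual_inner (sharp c) (\<zeta> + \<delta>) = 0"
    if "\<zeta> \<in> lie_center dual_br" "\<delta> \<in> commutator_ideal dual_br" for \<zeta> \<delta>
    using c that by (simp add: flat_complement_def)
  have flat_br: "bilinear dual_br"
    using flat_dual by (simp add: flat_lie_algebra_def lie_algebra_def)
  have "c \<bullet> D (R a) (D (R a) c) = 0" for a
  proof -
    \<comment> \<open>In this bracket the second term \<open>D (R (D (R a) c)) a\<close> vanishes.\<close>
    have "sharp (D (R a) (D (R a) c)) = dual_br (sharp a) (sharp (D (R a) c))"
      by (simp add: dual_bracket_sharp flip: parallel)
    then have "sharp (D (R a) (D (R a) c)) \<in> commutator_ideal dual_br"
      unfolding commutator_ideal_def by (auto intro: span_base)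
    moreover have "0 \<in> lie_center dual_br" by (simp add: lie_center_def bilinear_lzero[OF flat_br])
    ultimately have "dual_inner (sharp c) (sharp (D (R a) (D (R a) c))) = 0"
      using orth[of 0] by simp
    then show ?thesis by (simp only: dual_inner_sharp)
  qed
  then have Rc: "D (R a) c = 0" for a using zero_if by blast
  have "dual_br (sharp (D x (D x c))) \<beta> = 0" for \<beta>
  proof -
    obtain b where b: "\<beta> = sharp b" by (rule sharp_surj)
    have "D (R b) (D x (D x c)) = D x (D x (D (R b) c))" by (simp only: D_commute[of "R b"])
    then show ?thesis
      by (simp add: b dual_bracket_sharp Rc lin_simps linear_0[OF linear_sharp] flip: parallel)
  qed
  then have "sharp (D x (D x c)) \<in> lie_center dual_br" by (simp add: lie_center_def)
  moreover have "0 \<in> commutator_ideal dual_br" by (simp add: commutator_ideal_def span_zero)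
  ultimately have "dual_inner (sharp c) (sharp (D x (D x c))) = 0"
    using orth[of _ 0] by simp
  then have "c \<bullet> D x (D x c) = 0" by (simp only: dual_inner_sharp)
  then show ?thesis by (rule zero_if)
qed

text \<open>
  By the preceding lemma a functional in the summand \<open>s\<close> of the dual algebra is represented by a
  vector orthogonal to all \<open>D x y\<close>, hence to all brackets, so the dual cocycle already vanishes on it.
\<close>

theorem metaflat_dual:
  assumes coc: "one_cocycle bracket (coboundary bracket r)"
  shows "metaflat dual_br dual_inner (dual_cocycle bracket)"
proof -
  note D = dual_bases_euclidean[where 'v = 'v]
  have br: "bilinear dual_br"
    using flat_dual by (simp add: flat_lie_algebra_def lie_algebra_def)
  have "dual_cocycle bracket \<gamma> = 0" if \<gamma>: "\<gamma> \<in> flat_complement dual_br dual_inner" for \<gamma>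
  proof (rule bivector_dual_eqI[OF D])
    fix x y
    obtain c where c: "\<gamma> = sharp c" by (rule sharp_surj)
    have "D z c = 0" for z using flat_complement_dual_parallel \<gamma> c by blast
    then have "c \<bullet> D z t = 0" for z t using metric[of z c t] by simp
    then show "dual_cocycle bracket \<gamma> (evaluation x) (evaluation y)
        = (0 :: 'v dual bivector) (evaluation x) (evaluation y)"
      by (simp add: dual_cocycle_evaluation[OF D alternating_bracket] c bracket_def inner_diff_right)
  qed
  then show ?thesis
    using flat_dual one_cocycle_dual_cocycle[OF D alternating_bracket coc br]
      linear_0[OF linear_ad_bivector[OF dual_bases_dual[OF D] br]]
    by (simp add: metaflat_def)
qed

end

section \<open>Metaflat coboundaries solve the classical Yang-Baxter equation\<close>

theorem theorem3p3:
  fixes br :: "'g::euclidean_space \<Rightarrow> 'g \<Rightarrow> 'g"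
    and r :: "'g bivector"
    and \<xi> :: "'g \<Rightarrow> 'g bivector"
  assumes "flat_lie_algebra br (\<bullet>)"
    and "\<not> commutative_bracket br"
    and "r \<in> bivectors"
    and "\<xi> = coboundary br r"
    and "metaflat br (\<bullet>) \<xi>"
  shows "schouten br r r = 0 \<and>
    lie_bialgebra br \<xi> \<and>
    lie_bialgebra (dual_bracket \<xi>) (dual_cocycle br) \<and>
    flat_lie_algebra (dual_bracket \<xi>) dual_inner \<and>
    metaflat (dual_bracket \<xi>) dual_inner (dual_cocycle br)"
proof -
  obtain D where D: "flat_connection D" and br: "br = (\<lambda>x y. D x y - D y x)"
    by (rule flat_lie_algebra_imp_flat_connection[OF assms(1)]) (rule that)
  interpret flat_connection D by (rule D)
  have br': "bracket = br" by (intro ext) (simp add: bracket_def br)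
  have coc: "one_cocycle br \<xi>" using assms(5) by (simp add: metaflat_def)
  have "ad_bivector bracket x (ad_bivector bracket x (ad_bivector bracket x r)) = 0"
    if "\<And>k. k \<in> flat_kernel \<Longrightarrow> x \<bullet> k = 0" for x
  proof -
    have "x \<in> flat_complement br (\<bullet>)"
      unfolding br'[symmetric] by (rule orthogonal_flat_kernel_in_flat_complement[OF that])
    then show ?thesis
      using assms(5) by (simp add: metaflat_def assms(4) coboundary_def br')
  qed
  then interpret parallel_bivector D r
    by unfold_locales (use assms(3) bivector_operator_commutes in blast)+
  have flat: "flat_lie_algebra (dual_bracket \<xi>) dual_inner"
    using flat_dual by (simp add: br' assms(4))
  have "lie_bialgebra br \<xi>"
    using assms(1) coc flat by (simp add: lie_bialgebra_def flat_lie_algebra_def)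
  then show ?thesis
    using schouten_eq_0 flat metaflat_dual coc lie_bialgebra_dual[OF dual_bases_euclidean]
    by (simp add: br' assms(4))
qed

end
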